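(* Let $n\ge 2$, let $\mathcal{G}$ be a connected weighted undirected graph on $n$ vertices with Laplacian matrix $L$, and let $\lambda_2$ be the minimum non-zero eigenvalue of $L$. For real constants $\alpha,\beta>0$, let $T_1(s)$ and $T_2(s)$ be the transfer matrices from $\omega$ to $y$ of the closed-loop systems $$\begin{bmatrix} \dot x \\ \dot v \end{bmatrix}=\begin{bmatrix} \mathbf{0} & I_n \\ -\alpha L & -\beta M \end{bmatrix}\begin{bmatrix} x \\ v \end{bmatrix}+\begin{bmatrix} \mathbf{0} \\ I_n \end{bmatrix}\omega,\qquad y=\begin{bmatrix} \Phi_n & \mathbf{0} \\ \mathbf{0} & \Phi_n \end{bmatrix}\begin{bmatrix} x \\ v \end{bmatrix},$$ with $M=I_n$ for $T_1(s)$ (absolute velocity protocol) and $M=L$ for $T_2(s)$ (relative velocity protocol), where $\Phi_n=I_n-\frac1n\mathbf{1}_n\mathbf{1}_n^{\top}$. Then: 1) if $\lambda_2<1$, the absolute velocity protocol outperforms the relative velocity protocol, i.e., $\|T_1(s)\|_\infty\le\|T_2(s)\|_\infty$ for all $\alpha,\beta>0$; 2) if $\lambda_2>1$, the relative velocity protocol outperforms the absolute velocity protocol, i.e., $\|T_2(s)\|_\infty\le\|T_1(s)\|_\infty$ for all $\alpha,\beta>0$; 3) if $\lambda_2=1$, the two protocols perform equally well, i.e., $\|T_1(s)\|_\infty=\|T_2(s)\|_\infty$ for all $\alpha,\beta>0$.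
   Context: Graph: a weighted undirected graph on vertices $1,\dots,n$ is given by a symmetric weighted adjacency matrix $\mathcal{A}=[a_{ij}]\in\mathbb{R}^{n\times n}$ with $a_{ij}=a_{ji}\ge 0$ and $a_{ii}=0$; there is an edge between $i$ and $j$ iff $a_{ij}>0$. It is connected if any two distinct vertices are joined by a path. The Laplacian $L=[l_{ij}]$ has $l_{ii}=\sum_{j\ne i}a_{ij}$ and $l_{ij}=-a_{ij}$ for $j\neq i$. For a connected graph the eigenvalues of $L$ are $0=\lambda_1<\lambda_2\le\cdots\le\lambda_n$. System: the agents satisfy $\dot x_i=v_i$, $\dot v_i=u_i+\omega_i$ ($i=1,\dots,n$), with disturbance $\omega_i\in\mathcal{L}_2[0,\infty)$. The absolute velocity protocol is $u_i=\alpha\sum_{j=1}^n a_{ij}(x_j-x_i)-\beta v_i$; the relative velocity protocol is $u_i=\alpha\sum_{j=1}^n a_{ij}(x_j-x_i)+\beta\sum_{j=1}^n a_{ij}(v_j-v_i)$. The output $y$ stacks the consensus errors $x_i-\frac1n\sum_j x_j$ and $v_i-\frac1n\sum_j v_j$. The same gains $\alpha,\beta$ are used in both protocols when comparing. Here $\mathbf{1}_n$ is the all-ones column vector and $I_n$ the identity matrix. Transfer matrix and norm: for a system $\dot z=Az+B\omega$, $y=Cz$, the transfer matrix is the matrix of rational functions $T(s)=C(sI-A)^{-1}B$ (common factors cancelled; the modes of $A$ along the consensus direction, which are not asymptotically stable, are unobservable from $y$ and so contribute no poles to $T$). Its $H_\infty$ norm is $\|T(s)\|_\infty=\sup_{\upsilon\in\mathbb{R}}\sigma_{\max}[T(\mathbf{j}\upsilon)]$,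 where $\mathbf{j}$ is the imaginary unit and $\sigma_{\max}$ is the maximum singular value. *)

theory Defs
  imports
    "HOL-Library.Extended_Real"
    "HOL-Computational_Algebra.Field_as_Ring"
    "HOL-Computational_Algebra.Polynomial_Factorial"
    "Jordan_Normal_Form.Schur_Decomposition"
    "Jordan_Normal_Form.Gauss_Jordan_Elimination"
begin

section \<open>Weighted undirected graphs and their Laplacians\<close>

text \<open>The vertices are \<open>0, \<dots>, n - 1\<close>, as matrix indices start at 0.\<close>

definition adjacency_matrix :: "nat \<Rightarrow> real mat \<Rightarrow> bool" where
  "adjacency_matrix n W \<longleftrightarrow>
     W \<in> carrier_mat n n \<and>
     (\<forall>i<n. \<forall>j<n. W $$ (i, j) = W $$ (j, i) \<and> 0 \<le> W $$ (i, j)) \<and>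
     (\<forall>i<n. W $$ (i, i) = 0)"

definition edges :: "nat \<Rightarrow> real mat \<Rightarrow> (nat \<times> nat) set" where
  "edges n W = {(i, j). i < n \<and> j < n \<and> 0 < W $$ (i, j)}"

definition connected_graph :: "nat \<Rightarrow> real mat \<Rightarrow> bool" where
  "connected_graph n W \<longleftrightarrow> (\<forall>i<n. \<forall>j<n. i \<noteq> j \<longrightarrow> (i, j) \<in> (edges n W)\<^sup>*)"

definition laplacian :: "nat \<Rightarrow> real mat \<Rightarrow> real mat" where
  "laplacian n W =
     mat n n (\<lambda>(i, j). if i = j then \<Sum>k\<in>{..<n} - {i}. W $$ (i, k) else - W $$ (i, j))"

definition min_nonzero_eigenvalue :: "real mat \<Rightarrow> real" where
  "min_nonzero_eigenvalue L = Min {\<mu>. eigenvalue L \<mu> \<and> \<mu> \<noteq> 0}"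

section \<open>Transfer matrices and the \<open>H\<^sub>\<infinity>\<close> norm\<close>

type_synonym rat_fun = "complex poly fract"

definition const_rf :: "real \<Rightarrow> rat_fun" where
  "const_rf c = to_fract [:complex_of_real c:]"

text \<open>The indeterminate \<open>s\<close>.\<close>

definition var_rf :: rat_fun where
  "var_rf = to_fract [:0, 1:]"

text \<open>
  The inverse of \<open>s I - A\<close> is taken over the field of rational functions, where it always
  exists because the characteristic polynomial of \<open>A\<close> is non-zero.
\<close>

definition transfer_matrix :: "real mat \<Rightarrow> real mat \<Rightarrow> real mat \<Rightarrow> rat_fun mat" where
  "transfer_matrix A B C =
     map_mat const_rf C *
     the (mat_inverse (var_rf \<cdot>\<^sub>m 1\<^sub>m (dim_row A) - map_mat const_rf A)) *
     map_mat const_rf B"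

text \<open>
  The pair \<open>quot_of_fract r\<close> is coprime, so evaluation happens after cancelling common factors,
  and the denominator vanishes exactly at the poles of \<open>r\<close>. At a pole the value is the junk
  value 0.
\<close>

definition eval_rf :: "rat_fun \<Rightarrow> complex \<Rightarrow> complex" where
  "eval_rf r z = (case quot_of_fract r of (p, q) \<Rightarrow> poly p z / poly q z)"

definition singular_values :: "complex mat \<Rightarrow> real set" where
  "singular_values M =
     {\<sigma>. 0 \<le> \<sigma> \<and> eigenvalue (mat_adjoint M * M) (complex_of_real (\<sigma>\<^sup>2))}"

definition max_singular_value :: "complex mat \<Rightarrow> real" where
  "max_singular_value M = Max (singular_values M)"

text \<open>
  The supremum is extended-real. If some entry has a pole on the imaginary axis, the norm is
  \<open>\<infinity>\<close> because of the values near the pole, whatever the junk value at the pole itself.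
\<close>

definition hinf_norm :: "rat_fun mat \<Rightarrow> ereal" where
  "hinf_norm T =
     (SUP \<upsilon>::real. ereal (max_singular_value (map_mat (\<lambda>r. eval_rf r (\<i> * complex_of_real \<upsilon>)) T)))"

section \<open>The closed-loop systems\<close>

definition state_matrix :: "nat \<Rightarrow> real \<Rightarrow> real \<Rightarrow> real mat \<Rightarrow> real mat \<Rightarrow> real mat" where
  "state_matrix n \<alpha> \<beta> L M = four_block_mat (0\<^sub>m n n) (1\<^sub>m n) (- \<alpha> \<cdot>\<^sub>m L) (- \<beta> \<cdot>\<^sub>m M)"

definition input_matrix :: "nat \<Rightarrow> real mat" where
  "input_matrix n = 0\<^sub>m n n @\<^sub>r 1\<^sub>m n"

definition consensus_error_matrix :: "nat \<Rightarrow> real mat" where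
  "consensus_error_matrix n = 1\<^sub>m n - (1 / real n) \<cdot>\<^sub>m mat n n (\<lambda>_. 1)"

definition output_matrix :: "nat \<Rightarrow> real mat" where
  "output_matrix n =
     four_block_mat (consensus_error_matrix n) (0\<^sub>m n n) (0\<^sub>m n n) (consensus_error_matrix n)"

definition T_abs :: "nat \<Rightarrow> real mat \<Rightarrow> real \<Rightarrow> real \<Rightarrow> rat_fun mat" where
  "T_abs n L \<alpha> \<beta> =
     transfer_matrix (state_matrix n \<alpha> \<beta> L (1\<^sub>m n)) (input_matrix n) (output_matrix n)"

definition T_rel :: "nat \<Rightarrow> real mat \<Rightarrow> real \<Rightarrow> real \<Rightarrow> rat_fun mat" where
  "T_rel n L \<alpha> \<beta> =
     transfer_matrix (state_matrix n \<alpha> \<beta> L L) (input_matrix n) (output_matrix n)"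

end

(*
  On the consensus-free subspace the Laplacian is diagonalisable with positive eigenvalues x, and
  the closed loop splits into second-order modes. At frequency v the squared gain of the mode x is
  (1 + v^2) / ((alpha x - v^2)^2 + beta^2 m^2 v^2), with m = 1 for the absolute and m = x for the
  relative velocity protocol. Replacing x by lambda2 and v^2 by (lambda2 / x) v^2 does not decrease
  this gain, so in both cases the norm is attained on the mode lambda2, where the two gains differ
  only in m = 1 versus m = lambda2 and compare pointwise in v.

  No spectral theorem is needed: with J = I - Phi the averaging matrix and K = p Phi + q L + J,
  the transfer matrix at s consists of the blocks Y = K^-1 Phi and s Y, and a non-zero eigenvector
  of the Gram matrix is annihilated by a quadratic polynomial in L, hence yields an eigenvector
  of L.
*)

theory Submission
  imports Defs "Jordan_Normal_Form.Spectral_Radius"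
begin

section \<open>Evaluating transfer matrices\<close>

text \<open>The obstacle is frequency zero: \<open>L\<close> annihilates constant vectors, so s I -
  A is singular at s = 0, yet the supremum includes this point. Hence the inverse of s I - A is
  never evaluated at a point. Since the output projection C commutes with A, it suffices to exhibit
  a polynomial matrix S and a polynomial d with (s I - A) S = d C B. The projection on the right
  removes the consensus direction, so d can be chosen without zeros on the imaginary axis. Take K
  with p = s^2 + \<beta> a s and q = \<alpha> + \<beta> b s, where (a, b) = (1, 0) and (0, 1) are
  the two protocols. Then d = det K, and S stacks N and s N for N = adj K times \<Phi>. The
  quadratic polynomial arises as follows. A Gram eigenvalue \<mu> with vector x gives \<mu> x = c
  Y^H Y x with c = 1 + |s|^2. If \<mu> is non-zero, then x has zero sum, and multiplying by K^H and
  then by K yields \<mu> (p + q L) (cnj p + cnj q L) x = c x. The eigenvector of L extracted from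
  this is a combination of x and L x, so it has zero sum as well and its eigenvalue l is positive;
  the root equation for l reads \<mu> |p + q l|^2 = c.\<close>

lemma eval_rf_to_fract_divide:
  fixes p q :: "complex poly"
  assumes q: "poly q z \<noteq> 0"
  shows "eval_rf (to_fract p / to_fract q) z = poly p z / poly q z"
proof -
  define r where "r = to_fract p / to_fract q"
  obtain a b where ab: "quot_of_fract r = (a, b)" by fastforce
  have q0: "q \<noteq> 0" using q by auto
  have b0: "b \<noteq> 0" using snd_quot_of_fract_nonzero[of r] ab by simp
  have cop: "coprime a b" using coprime_quot_of_fract[of r] ab by simp
  have "Fract a b = r" using Fract_quot_of_fract[of r] ab by simp
  also have "r = Fract p q" unfolding r_def to_fract_def using q0 by simp
  finally have "Fract a b = Fract p q" .
  then have eq: "a * q = p * b" using b0 q0 by (simp add: eq_fract)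
  \<comment> \<open>Coprimality makes the reduced denominator a divisor of any other denominator, so
    a point where \<open>q\<close> does not vanish is no pole.\<close>
  then have "b dvd q" using cop
    by (metis coprime_commute coprime_dvd_mult_right_iff dvd_triv_right)
  then have "poly b z \<noteq> 0" using q by (auto elim!: dvdE)
  moreover have "poly a z * poly q z = poly p z * poly b z" using eq by (metis poly_mult)
  ultimately have "poly a z / poly b z = poly p z / poly q z" using q by (simp add: field_simps)
  then show ?thesis unfolding eval_rf_def r_def[symmetric] ab by simp
qed

text \<open>Matrix identities are proved over polynomials rather than fractions because evaluation
  at a point is a ring homomorphism only there.\<close>

definition const_poly :: "real \<Rightarrow> complex poly" where
  "const_poly c = [:complex_of_real c:]"

interpretation const_poly: comm_ring_hom const_poly
  by unfold_locales (simp_all add: const_poly_def one_pCons)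

lemma map_mat_const_rf: "map_mat const_rf X = map_mat to_fract (map_mat const_poly X)"
  by (rule eq_matI) (simp_all add: const_rf_def const_poly_def)

lemma det_char_matrix_nonzero:
  assumes A: "A \<in> carrier_mat m m"
  shows "det ([:0, 1:] \<cdot>\<^sub>m 1\<^sub>m m - map_mat const_poly A) \<noteq> 0"
proof -
  have A': "map_mat complex_of_real A \<in> carrier_mat m m" using A by simp
  have "[:0, 1:] \<cdot>\<^sub>m 1\<^sub>m m - map_mat const_poly A = char_poly_matrix (map_mat complex_of_real A)"
    by (rule eq_matI) (use A in \<open>auto simp: char_poly_matrix_def const_poly_def\<close>)
  then have "det ([:0, 1:] \<cdot>\<^sub>m 1\<^sub>m m - map_mat const_poly A) = char_poly (map_mat complex_of_real A)"
    by (simp add: char_poly_def)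
  then show ?thesis using degree_monic_char_poly[OF A'] by auto
qed

interpretation to_fract: comm_ring_hom "to_fract :: complex poly \<Rightarrow> _"
  by unfold_locales simp_all

text \<open>Replaces the computation of the inverse by a certificate. The inverse of s I - A
  inherits from \<open>A\<close> that it commutes with \<open>C\<close>, so applying it to
  \<open>eq\<close> turns the right-hand side into \<open>d\<close> times C (s I - A)^-1 B.\<close>

lemma transfer_matrix_eqI:
  fixes A B C :: "real mat"
  assumes A: "A \<in> carrier_mat m m" and B: "B \<in> carrier_mat m k" and C: "C \<in> carrier_mat m m"
    and S: "S \<in> carrier_mat m k" and d: "d \<noteq> 0"
    and comm: "C * A = A * C"
    and eq: "([:0, 1:] \<cdot>\<^sub>m 1\<^sub>m m - map_mat const_poly A) * S = d \<cdot>\<^sub>m map_mat const_poly (C * B)"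
  shows "transfer_matrix A B C = map_mat (\<lambda>p. to_fract p / to_fract d) S"
proof -
  define Ep where "Ep = [:0, 1:] \<cdot>\<^sub>m 1\<^sub>m m - map_mat const_poly A"
  define E where "E = map_mat to_fract Ep"
  define CF where "CF = map_mat const_rf C"
  define BF where "BF = map_mat const_rf B"
  define SF where "SF = map_mat to_fract S"
  have Ep: "Ep \<in> carrier_mat m m" unfolding Ep_def using A by auto
  then have E: "E \<in> carrier_mat m m" unfolding E_def by auto
  have CF: "CF \<in> carrier_mat m m" and BF: "BF \<in> carrier_mat m k" and SF: "SF \<in> carrier_mat m k"
    using B C S unfolding CF_def BF_def SF_def by auto
  have Eeq: "var_rf \<cdot>\<^sub>m 1\<^sub>m (dim_row A) - map_mat const_rf A = E"
    unfolding E_def Ep_def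
    by (rule eq_matI) (use A in \<open>auto simp: var_rf_def const_rf_def const_poly_def
      to_fract_diff[symmetric] to_fract_uminus[symmetric] simp del: to_fract_diff to_fract_uminus\<close>)
  have "det E = to_fract (det Ep)" unfolding E_def by simp
  then have "det E \<noteq> 0" using det_char_matrix_nonzero[OF A] by (simp add: Ep_def)
  then have "E \<in> Units (ring_mat TYPE(rat_fun) m ())" by (rule det_non_zero_imp_unit[OF E])
  then obtain R where R: "mat_inverse E = Some R"
    using mat_inverse(1)[OF E, where b="()"] by (cases "mat_inverse E") auto
  have RE: "R * E = 1\<^sub>m m" "E * R = 1\<^sub>m m" and Rc: "R \<in> carrier_mat m m"
    using mat_inverse(2)[OF E R] by auto
  have EC: "E * CF = CF * E"
  proof -
    have "Ep * map_mat const_poly C = [:0, 1:] \<cdot>\<^sub>m map_mat const_poly C - map_mat const_poly (A * C)"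
      unfolding Ep_def using A C
      by (subst minus_mult_distrib_mat[of _ m m _ _ m])
         (auto simp: const_poly.mat_hom_mult[OF A C] mult_smult_assoc_mat[of _ m m _ m])
    moreover have "map_mat const_poly C * Ep
        = [:0, 1:] \<cdot>\<^sub>m map_mat const_poly C - map_mat const_poly (C * A)"
      unfolding Ep_def using A C
      by (subst mult_minus_distrib_mat[of _ m m _ m])
         (auto simp: const_poly.mat_hom_mult[OF C A] mult_smult_distrib[of _ m m _ m])
    ultimately have "Ep * map_mat const_poly C = map_mat const_poly C * Ep" using comm by simp
    then show ?thesis unfolding E_def CF_def map_mat_const_rf
      using to_fract.mat_hom_mult[OF Ep, of "map_mat const_poly C" m]
        to_fract.mat_hom_mult[of "map_mat const_poly C" m m Ep m] Ep C by simp
  qed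
  \<comment> \<open>Inserting \<open>E * R\<close> and moving \<open>E\<close> past
    \<open>CF\<close> transfers commutation from \<open>E\<close> to its inverse.\<close>
  have "R * CF = R * (CF * (E * R))" using CF RE by simp
  also have "\<dots> = R * (CF * E) * R" using CF E Rc by (simp add: assoc_mult_mat[of _ m m _ m _ m])
  also have "\<dots> = R * E * CF * R" using EC CF E Rc by (simp add: assoc_mult_mat[of _ m m _ m _ m])
  finally have RC: "R * CF = CF * R" using RE CF by simp
  have EqF: "E * SF = to_fract d \<cdot>\<^sub>m (CF * BF)"
  proof -
    have "E * SF = map_mat to_fract (Ep * S)"
      unfolding E_def SF_def using to_fract.mat_hom_mult[OF Ep S] by simp
    also have "\<dots> = map_mat to_fract (d \<cdot>\<^sub>m map_mat const_poly (C * B))" using eq by (simp add: Ep_def)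
    also have "\<dots> = to_fract d \<cdot>\<^sub>m map_mat to_fract (map_mat const_poly (C * B))"
      by (rule eq_matI) auto
    also have "map_mat to_fract (map_mat const_poly (C * B)) = CF * BF"
      unfolding CF_def BF_def map_mat_const_rf const_poly.mat_hom_mult[OF C B]
      by (rule to_fract.mat_hom_mult) (use C B in auto)
    finally show ?thesis .
  qed
  define T where "T = CF * R * BF"
  have T: "T \<in> carrier_mat m k" unfolding T_def using CF Rc BF by auto
  have "SF = R * (E * SF)" using RE SF Rc E by (simp flip: assoc_mult_mat[of _ m m _ m _ k])
  also have "\<dots> = to_fract d \<cdot>\<^sub>m (R * (CF * BF))"
    unfolding EqF using Rc CF BF by (simp add: mult_smult_distrib[of _ m m _ k])
  also have "R * (CF * BF) = T"
    unfolding T_def RC[symmetric] using Rc CF BF by (simp add: assoc_mult_mat[of _ m m _ m _ k])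
  finally have ST: "SF = to_fract d \<cdot>\<^sub>m T" .
  have "T = map_mat (\<lambda>p. to_fract p / to_fract d) S"
  proof (rule eq_matI)
    fix i j assume "i < dim_row (map_mat (\<lambda>p. to_fract p / to_fract d) S)"
      "j < dim_col (map_mat (\<lambda>p. to_fract p / to_fract d) S)"
    then have ij: "i < m" "j < k" using S by auto
    have "SF $$ (i, j) = to_fract d * T $$ (i, j)" using ST T ij by simp
    moreover have "SF $$ (i, j) = to_fract (S $$ (i, j))" unfolding SF_def using S ij by simp
    ultimately show "T $$ (i, j) = map_mat (\<lambda>p. to_fract p / to_fract d) S $$ (i, j)"
      using S ij d by (simp add: field_simps)
  qed (use T S in auto)
  then show ?thesis
    unfolding transfer_matrix_def Eeq R T_def CF_def BF_def by simp
qed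

section \<open>The Laplacian of a connected graph\<close>

definition averaging_matrix :: "nat \<Rightarrow> real mat" where
  "averaging_matrix n = (1 / real n) \<cdot>\<^sub>m mat n n (\<lambda>_. 1)"

lemma averaging_matrix_carrier [simp]: "averaging_matrix n \<in> carrier_mat n n"
  by (simp add: averaging_matrix_def)

lemma consensus_error_matrix_carrier [simp]: "consensus_error_matrix n \<in> carrier_mat n n"
  by (auto simp: consensus_error_matrix_def)

lemma averaging_matrix_dim [simp]:
  "dim_row (averaging_matrix n) = n" "dim_col (averaging_matrix n) = n"
  by (simp_all add: averaging_matrix_def)

lemma consensus_error_matrix_dim [simp]:
  "dim_row (consensus_error_matrix n) = n" "dim_col (consensus_error_matrix n) = n"
  by (simp_all add: consensus_error_matrix_def)

lemma consensus_error_matrix_eq: "consensus_error_matrix n = 1\<^sub>m n - averaging_matrix n"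
  by (simp add: consensus_error_matrix_def averaging_matrix_def)

lemma averaging_matrix_idem: "averaging_matrix n * averaging_matrix n = averaging_matrix n"
  by (rule eq_matI) (auto simp: averaging_matrix_def scalar_prod_def)

lemma mult_vec_averaging:
  assumes "v \<in> carrier_vec n" "i < n"
  shows "(map_mat complex_of_real (averaging_matrix n) *\<^sub>v v) $ i = (\<Sum>j<n. v $ j) / of_nat n"
  using assms
  by (simp add: averaging_matrix_def scalar_prod_def atLeast0LessThan sum_divide_distrib)

locale connected_weighted_graph =
  fixes n :: nat and W :: "real mat"
  assumes n_ge_2: "2 \<le> n"
    and adjacency: "adjacency_matrix n W"
    and connected: "connected_graph n W"
begin

abbreviation L :: "real mat" where "L \<equiv> laplacian n W"

abbreviation Lc :: "complex mat" where "Lc \<equiv> map_mat complex_of_real L"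

lemma W_sym: "i < n \<Longrightarrow> j < n \<Longrightarrow> W $$ (i, j) = W $$ (j, i)"
  and W_nonneg: "i < n \<Longrightarrow> j < n \<Longrightarrow> 0 \<le> W $$ (i, j)"
  and W_diag: "i < n \<Longrightarrow> W $$ (i, i) = 0"
  using adjacency by (auto simp: adjacency_matrix_def)

lemma L_carrier [simp]: "L \<in> carrier_mat n n"
  by (simp add: laplacian_def)

lemma L_dim [simp]: "dim_row L = n" "dim_col L = n"
  by (simp_all add: laplacian_def)

text \<open>The zero diagonal of \<open>W\<close> lets the degree sum run over all of
  \<open>{..<n}\<close>, which spares the later sums the exclusion of \<open>i\<close>.\<close>

lemma L_entry:
  assumes "i < n" "j < n"
  shows "L $$ (i, j) = (if i = j then \<Sum>k<n. W $$ (i, k) else 0) - W $$ (i, j)"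
proof -
  have "(\<Sum>k<n. W $$ (i, k)) = W $$ (i, i) + (\<Sum>k\<in>{..<n} - {i}. W $$ (i, k))"
    by (rule sum.remove) (use assms in auto)
  then show ?thesis using assms by (auto simp: laplacian_def W_diag)
qed

lemma L_sym: "i < n \<Longrightarrow> j < n \<Longrightarrow> L $$ (i, j) = L $$ (j, i)"
  using W_sym by (auto simp: L_entry)

lemma L_row_sum: "i < n \<Longrightarrow> (\<Sum>j<n. L $$ (i, j)) = 0"
  by (simp add: L_entry sum_subtractf)

lemma L_averaging: "L * averaging_matrix n = 0\<^sub>m n n"
  by (rule eq_matI)
     (auto simp: averaging_matrix_def scalar_prod_def atLeast0LessThan L_row_sum
       simp flip: sum_divide_distrib)

lemma averaging_L: "averaging_matrix n * L = 0\<^sub>m n n"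
proof (rule eq_matI)
  fix i j assume "i < dim_row (0\<^sub>m n n :: real mat)" "j < dim_col (0\<^sub>m n n :: real mat)"
  then have ij: "i < n" "j < n" by auto
  have "(\<Sum>k<n. L $$ (k, j)) = (\<Sum>k<n. L $$ (j, k))"
    by (rule sum.cong) (use ij L_sym in auto)
  then show "(averaging_matrix n * L) $$ (i, j) = 0\<^sub>m n n $$ (i, j)"
    using ij by (simp add: averaging_matrix_def scalar_prod_def atLeast0LessThan L_row_sum
       flip: sum_divide_distrib)
qed (auto simp: averaging_matrix_def)

lemma Lc_mult_vec:
  assumes "v \<in> carrier_vec n" "i < n"
  shows "(Lc *\<^sub>v v) $ i = (\<Sum>j<n. of_real (W $$ (i, j)) * (v $ i - v $ j))"
proof -
  have "(Lc *\<^sub>v v) $ i = (\<Sum>j<n. of_real (L $$ (i, j)) * v $ j)"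
    using assms by (simp add: scalar_prod_def atLeast0LessThan)
  also have "\<dots> = (\<Sum>j<n. (if i = j then of_real (\<Sum>k<n. W $$ (i, k)) * v $ j else 0)
      - of_real (W $$ (i, j)) * v $ j)"
    by (rule sum.cong) (use assms in \<open>auto simp: L_entry algebra_simps\<close>)
  also have "\<dots> = (\<Sum>j<n. of_real (W $$ (i, j)) * (v $ i - v $ j))"
    using assms by (simp add: sum_subtractf sum_distrib_left algebra_simps)
  finally show ?thesis .
qed

text \<open>Exchanging the two summation indices flips the sign of every summand because
  \<open>W\<close> is symmetric. Thus the image of \<open>Lc\<close> consists of zero-sum
  vectors.\<close>

lemma sum_Lc_mult_vec:
  assumes "v \<in> carrier_vec n"
  shows "(\<Sum>i<n. (Lc *\<^sub>v v) $ i) = 0"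
proof -
  define S where "S = (\<Sum>i<n. \<Sum>j<n. complex_of_real (W $$ (i, j)) * (v $ i - v $ j))"
  have "S = (\<Sum>j<n. \<Sum>i<n. complex_of_real (W $$ (i, j)) * (v $ i - v $ j))"
    unfolding S_def by (rule sum.swap)
  also have "\<dots> = (\<Sum>i<n. \<Sum>j<n. - (complex_of_real (W $$ (i, j)) * (v $ i - v $ j)))"
    by (intro sum.cong refl) (use W_sym in \<open>auto simp: algebra_simps\<close>)
  also have "\<dots> = - S" by (simp add: S_def sum_negf)
  finally have "S = 0" by simp
  then show ?thesis using assms by (simp add: Lc_mult_vec S_def del: index_mult_mat_vec)
qed

text \<open>Adding the double sum to its index-swapped copy completes each term to a squared
  modulus. This energy identity yields both the sign of the eigenvalues and the kernel.\<close>

lemma Lc_quadratic_form: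
  assumes v: "v \<in> carrier_vec n"
  shows "(\<Sum>i<n. cnj (v $ i) * (Lc *\<^sub>v v) $ i)
    = of_real ((\<Sum>i<n. \<Sum>j<n. W $$ (i, j) * (cmod (v $ i - v $ j))\<^sup>2) / 2)"
proof -
  define S where "S = (\<Sum>i<n. \<Sum>j<n. complex_of_real (W $$ (i, j)) * cnj (v $ i) * (v $ i - v $ j))"
  have S1: "(\<Sum>i<n. cnj (v $ i) * (Lc *\<^sub>v v) $ i) = S"
    unfolding S_def by (rule sum.cong) (auto simp: Lc_mult_vec[OF v] sum_distrib_left algebra_simps simp del: index_mult_mat_vec)
  have "S = (\<Sum>j<n. \<Sum>i<n. complex_of_real (W $$ (i, j)) * cnj (v $ i) * (v $ i - v $ j))"
    unfolding S_def by (rule sum.swap)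
  also have "\<dots> = (\<Sum>i<n. \<Sum>j<n. - (complex_of_real (W $$ (i, j)) * cnj (v $ j) * (v $ i - v $ j)))"
    by (intro sum.cong refl) (use W_sym in \<open>auto simp: algebra_simps\<close>)
  finally have S2: "S = \<dots>" .
  have "S + S = (\<Sum>i<n. \<Sum>j<n. complex_of_real (W $$ (i, j)) * (cnj (v $ i - v $ j) * (v $ i - v $ j)))"
    by (subst (2) S2) (simp add: S_def flip: sum.distrib, simp add: algebra_simps)
  also have "\<dots> = (\<Sum>i<n. \<Sum>j<n. of_real (W $$ (i, j) * (cmod (v $ i - v $ j))\<^sup>2))"
    by (intro sum.cong refl) (simp only: of_real_mult complex_norm_square mult.commute)
  finally have "2 * S = of_real (\<Sum>i<n. \<Sum>j<n. W $$ (i, j) * (cmod (v $ i - v $ j))\<^sup>2)"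
    by simp
  then show ?thesis unfolding S1 by (simp add: mult.commute)
qed

lemma Lc_eigenvalue_real_nonneg:
  assumes v: "v \<in> carrier_vec n" and v0: "v \<noteq> 0\<^sub>v n" and ev: "Lc *\<^sub>v v = \<mu> \<cdot>\<^sub>v v"
  shows "\<exists>x\<ge>0. \<mu> = of_real x"
proof -
  define N where "N = (\<Sum>i<n. (cmod (v $ i))\<^sup>2)"
  define Q where "Q = (\<Sum>i<n. \<Sum>j<n. W $$ (i, j) * (cmod (v $ i - v $ j))\<^sup>2) / 2"
  obtain i where i: "i < n" "v $ i \<noteq> 0" using v v0 by (metis carrier_vecD eq_vecI index_zero_vec)
  have "N \<noteq> 0" using i unfolding N_def by (subst sum_nonneg_eq_0_iff) auto
  then have N: "N > 0" unfolding N_def by (simp add: order.not_eq_order_implies_strict sum_nonneg)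
  have Q: "Q \<ge> 0" unfolding Q_def using W_nonneg by (auto intro!: sum_nonneg)
  have "(\<Sum>i<n. cnj (v $ i) * (Lc *\<^sub>v v) $ i) = (\<Sum>i<n. \<mu> * (v $ i * cnj (v $ i)))"
    unfolding ev using v by (auto intro!: sum.cong)
  also have "\<dots> = \<mu> * of_real N"
    by (simp add: N_def flip: sum_distrib_left complex_norm_square)
  finally have "\<mu> * of_real N = of_real Q"
    using Lc_quadratic_form[OF v] by (simp add: Q_def)
  \<comment> \<open>The eigenvalue is the Rayleigh quotient of its eigenvector, a quotient of two
    real non-negative sums.\<close>
  then have "\<mu> = of_real (Q / N)" using N by (simp add: field_simps)
  then show ?thesis using N Q by (intro exI[of _ "Q / N"]) simp
qed

text \<open>Zero energy forces equal values at the ends of every edge, and a path carries the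
  equality between any two vertices.\<close>

lemma Lc_kernel_constant:
  assumes v: "v \<in> carrier_vec n" and ker: "Lc *\<^sub>v v = 0\<^sub>v n" and "i < n" "j < n"
  shows "v $ i = v $ j"
proof -
  have "(\<Sum>i<n. \<Sum>j<n. W $$ (i, j) * (cmod (v $ i - v $ j))\<^sup>2) = 0"
    using Lc_quadratic_form[OF v] unfolding ker by (simp del: of_real_sum of_real_mult)
  then have *: "\<forall>i\<in>{..<n}. (\<Sum>j<n. W $$ (i, j) * (cmod (v $ i - v $ j))\<^sup>2) = 0"
    by (subst (asm) sum_nonneg_eq_0_iff) (use W_nonneg in \<open>auto intro!: sum_nonneg\<close>)
  have zero: "W $$ (i, j) * (cmod (v $ i - v $ j))\<^sup>2 = 0" if "i < n" "j < n" for i j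
  proof -
    have "(\<Sum>j<n. W $$ (i, j) * (cmod (v $ i - v $ j))\<^sup>2) = 0" using * that by simp
    then have "\<forall>j\<in>{..<n}. W $$ (i, j) * (cmod (v $ i - v $ j))\<^sup>2 = 0"
      by (subst (asm) sum_nonneg_eq_0_iff) (use W_nonneg that in auto)
    then show ?thesis using that by simp
  qed
  have "v $ i = v $ k" if "(i, k) \<in> (edges n W)\<^sup>*" for k
    using that
  proof (induction rule: rtrancl_induct)
    case (step k l)
    then have "k < n" "l < n" "0 < W $$ (k, l)" by (auto simp: edges_def)
    with zero[of k l] step.IH show ?case by simp
  qed simp
  then show ?thesis using connected assms(3,4) by (cases "i = j") (auto simp: connected_graph_def)
qed

lemma Lc_kernel_sum_zero:
  assumes v: "v \<in> carrier_vec n" and ker: "Lc *\<^sub>v v = 0\<^sub>v n" and sum: "(\<Sum>i<n. v $ i) = 0"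
  shows "v = 0\<^sub>v n"
proof (rule eq_vecI)
  fix i assume "i < dim_vec (0\<^sub>v n :: complex vec)"
  then have i: "i < n" by simp
  have "(\<Sum>j<n. v $ j) = (\<Sum>j<n. v $ i)"
    by (intro sum.cong refl Lc_kernel_constant[OF v ker]) (use i in auto)
  then show "v $ i = 0\<^sub>v n $ i" using sum n_ge_2 i by simp
qed (use v in auto)

text \<open>\<open>min_nonzero_eigenvalue\<close> refers to the real matrix, whereas eigenvectors
  are found over the complex numbers; the characteristic polynomials agree up to the
  embedding.\<close>

lemma eigenvalue_Lc_iff: "eigenvalue Lc (of_real x) \<longleftrightarrow> eigenvalue L x"
proof -
  have "Lc \<in> carrier_mat n n" by simp
  then show ?thesis
    by (simp add: eigenvalue_root_char_poly[of Lc n] of_real_hom.char_poly_hom[OF L_carrier]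
        eigenvalue_root_char_poly[OF L_carrier])
qed

lemma Lc_eigenvector_sum_zero:
  assumes v: "v \<in> carrier_vec n" and ev: "Lc *\<^sub>v v = \<mu> \<cdot>\<^sub>v v" and \<mu>: "\<mu> \<noteq> 0"
  shows "(\<Sum>i<n. v $ i) = 0"
proof -
  have "\<mu> * (\<Sum>i<n. v $ i) = (\<Sum>i<n. (Lc *\<^sub>v v) $ i)"
    unfolding ev sum_distrib_left using v by (auto intro!: sum.cong)
  then show ?thesis using \<mu> sum_Lc_mult_vec[OF v] by simp
qed

text \<open>A kernel vector is constant, and a constant vector of zero sum vanishes. Every
  eigenvector built later passes through this lemma to become a positive real eigenvalue of
  \<open>L\<close>.\<close>

lemma Lc_eigenvector_sum_zero_pos:
  assumes v: "v \<in> carrier_vec n" and v0: "v \<noteq> 0\<^sub>v n" and ev: "Lc *\<^sub>v v = \<mu> \<cdot>\<^sub>v v"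
    and sum: "(\<Sum>i<n. v $ i) = 0"
  shows "\<exists>x>0. \<mu> = of_real x \<and> eigenvalue L x"
proof -
  obtain x where x: "x \<ge> 0" "\<mu> = of_real x" using Lc_eigenvalue_real_nonneg[OF v v0 ev] by auto
  have "x \<noteq> 0"
  proof
    assume "x = 0"
    then have "Lc *\<^sub>v v = 0\<^sub>v n" using ev x v by auto
    then show False using Lc_kernel_sum_zero[OF v _ sum] v0 by auto
  qed
  moreover have "eigenvalue Lc \<mu>" using v v0 ev by (auto simp: eigenvalue_def eigenvector_def)
  ultimately show ?thesis using x eigenvalue_Lc_iff by auto
qed

lemma eigenvalue_L_vec:
  assumes "eigenvalue L x" "x \<noteq> 0"
  obtains v where "v \<in> carrier_vec n" "v \<noteq> 0\<^sub>v n" "Lc *\<^sub>v v = of_real x \<cdot>\<^sub>v v"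
    "(\<Sum>i<n. v $ i) = 0" "x > 0"
proof -
  obtain v where v: "v \<in> carrier_vec n" "v \<noteq> 0\<^sub>v n" "Lc *\<^sub>v v = of_real x \<cdot>\<^sub>v v"
    using assms(1) unfolding eigenvalue_Lc_iff[symmetric] by (auto simp: eigenvalue_def eigenvector_def)
  have sum: "(\<Sum>i<n. v $ i) = 0" by (rule Lc_eigenvector_sum_zero[OF v(1,3)]) (use assms in simp)
  have "x > 0" using Lc_eigenvector_sum_zero_pos[OF v sum] by auto
  with v sum that show thesis by blast
qed

text \<open>The matrix \<open>R\<close> below represents the map induced by the Laplacian on the quotient of
  \<open>\<complex>\<^sup>n\<close> by the constant vectors, where it is injective.\<close>

lemma exists_nonzero_eigenvalue: "\<exists>x. eigenvalue L x \<and> x \<noteq> 0"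
proof -
  define m where "m = n - 1"
  have m: "m < n" "m > 0" and nm: "n = Suc m" using n_ge_2 by (auto simp: m_def)
  define R where "R = mat m m (\<lambda>(i, j). Lc $$ (i, j) - Lc $$ (m, j))"
  have R: "R \<in> carrier_mat m m" by (simp add: R_def)
  obtain \<mu> where "\<mu> \<in> spectrum R" using spectrum_non_empty[OF R m(2)] by auto
  then obtain d where d: "d \<in> carrier_vec m" "d \<noteq> 0\<^sub>v m" "R *\<^sub>v d = \<mu> \<cdot>\<^sub>v d"
    using R by (auto simp: spectrum_def eigenvalue_def eigenvector_def)
  \<comment> \<open>The representative, modulo constants, whose last coordinate is 0.\<close>
  define x where "x = vec n (\<lambda>i. if i < m then d $ i else 0)"
  have x: "x \<in> carrier_vec n" by (simp add: x_def)
  \<comment> \<open>\<open>R\<close> only sees differences to row \<open>m\<close>, so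
    \<open>Lc *\<^sub>v x\<close> agrees with \<open>\<mu> \<cdot>\<^sub>v x\<close> up to the
    constant vector with entry \<open>c\<close>.\<close>
  define c where "c = (Lc *\<^sub>v x) $ m"
  have Lx: "(Lc *\<^sub>v x) $ i = (\<Sum>j<m. Lc $$ (i, j) * d $ j)" if "i < n" for i
  proof -
    have "(Lc *\<^sub>v x) $ i = (\<Sum>j<n. Lc $$ (i, j) * x $ j)"
      using that x by (simp add: scalar_prod_def atLeast0LessThan)
    also have "\<dots> = (\<Sum>j<Suc m. Lc $$ (i, j) * x $ j)" using nm by simp
    also have "\<dots> = (\<Sum>j<m. Lc $$ (i, j) * x $ j)" using m(1) by (simp add: x_def)
    also have "\<dots> = (\<Sum>j<m. Lc $$ (i, j) * d $ j)" by (rule sum.cong) (use m(1) in \<open>auto simp: x_def\<close>)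
    finally show ?thesis .
  qed
  have eq: "(Lc *\<^sub>v x) $ i = \<mu> * x $ i + c" if "i < n" for i
  proof (cases "i < m")
    case True
    have "\<mu> * d $ i = (R *\<^sub>v d) $ i" unfolding d(3) using True d(1) by simp
    also have "\<dots> = (\<Sum>j<m. (Lc $$ (i, j) - Lc $$ (m, j)) * d $ j)"
      using True d(1) R by (simp add: R_def scalar_prod_def atLeast0LessThan)
    also have "\<dots> = (Lc *\<^sub>v x) $ i - c"
      using that m by (simp only: c_def Lx sum_subtractf left_diff_distrib)
    finally show ?thesis using that True by (simp add: x_def)
  next
    case False
    then have "i = m" using that nm by simp
    then show ?thesis using that by (simp add: x_def c_def)
  qed
  \<comment> \<open>Otherwise \<open>Lc *\<^sub>v x\<close> would be constant with zero sum, hence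
    zero, and \<open>x\<close> would be constant with last coordinate 0.\<close>
  have \<mu>0: "\<mu> \<noteq> 0"
  proof
    assume "\<mu> = 0"
    then have "(\<Sum>i<n. (Lc *\<^sub>v x) $ i) = of_nat n * c" using eq by simp
    then have "c = 0" using sum_Lc_mult_vec[OF x] m by auto
    then have ker: "Lc *\<^sub>v x = 0\<^sub>v n" using eq \<open>\<mu> = 0\<close> by (intro eq_vecI) auto
    have "d $ i = 0" if "i < m" for i
      using Lc_kernel_constant[OF x ker, of i m] that m by (simp add: x_def)
    then show False using d by (metis carrier_vecD eq_vecI index_zero_vec)
  qed
  \<comment> \<open>Adding a constant does not change the image under \<open>Lc\<close>; the shift c
    / \<mu> absorbs the error term \<open>c\<close>.\<close>
  define v where "v = vec n (\<lambda>i. x $ i + c / \<mu>)"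
  have v: "v \<in> carrier_vec n" by (simp add: v_def)
  have "v \<noteq> 0\<^sub>v n"
  proof
    assume v0: "v = 0\<^sub>v n"
    have vi: "x $ i + c / \<mu> = 0" if "i < n" for i
      using arg_cong[OF v0, of "\<lambda>u. u $ i"] that by (simp add: v_def)
    from vi[of m] m have "c / \<mu> = 0" by (simp add: x_def)
    then have "d $ i = 0" if "i < m" for i using vi[of i] that m \<mu>0 by (simp add: x_def)
    then show False using d by (metis carrier_vecD eq_vecI index_zero_vec)
  qed
  then have "\<exists>x>0. \<mu> = of_real x \<and> eigenvalue L x" if "Lc *\<^sub>v v = \<mu> \<cdot>\<^sub>v v"
    by (rule Lc_eigenvector_sum_zero_pos[OF v _ that Lc_eigenvector_sum_zero[OF v that \<mu>0]])
  moreover have "Lc *\<^sub>v v = \<mu> \<cdot>\<^sub>v v"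
  proof (rule eq_vecI)
    fix i assume "i < dim_vec (\<mu> \<cdot>\<^sub>v v)"
    then have i: "i < n" by (simp add: v_def)
    have "(Lc *\<^sub>v v) $ i = (\<Sum>j<n. of_real (W $$ (i, j)) * (v $ i - v $ j))"
      by (rule Lc_mult_vec[OF v i])
    also have "\<dots> = (\<Sum>j<n. of_real (W $$ (i, j)) * (x $ i - x $ j))"
      by (rule sum.cong) (use i in \<open>auto simp: v_def\<close>)
    also have "\<dots> = \<mu> * x $ i + c" 
      by (rule trans[OF Lc_mult_vec[OF x i, symmetric] eq[OF i]])
    also have "\<dots> = (\<mu> \<cdot>\<^sub>v v) $ i" using i \<mu>0 by (simp add: v_def distrib_left)
    finally show "(Lc *\<^sub>v v) $ i = (\<mu> \<cdot>\<^sub>v v) $ i" .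
  qed (simp add: v_def)
  ultimately obtain r where "r > 0" "eigenvalue L r" by blast
  then show ?thesis by (intro exI[of _ r] conjI) simp_all
qed

lemma finite_eigenvalues: "finite {x. eigenvalue L x}"
  using card_finite_spectrum(1)[OF L_carrier] by (simp add: spectrum_def)

lemma min_nonzero_eigenvalue:
  "eigenvalue L (min_nonzero_eigenvalue L)" "min_nonzero_eigenvalue L \<noteq> 0"
  "eigenvalue L x \<Longrightarrow> x \<noteq> 0 \<Longrightarrow> min_nonzero_eigenvalue L \<le> x"
proof -
  have fin: "finite {x. eigenvalue L x \<and> x \<noteq> 0}"
    by (rule finite_subset[OF _ finite_eigenvalues]) auto
  have ne: "{x. eigenvalue L x \<and> x \<noteq> 0} \<noteq> {}" using exists_nonzero_eigenvalue by auto
  show "eigenvalue L (min_nonzero_eigenvalue L)" "min_nonzero_eigenvalue L \<noteq> 0"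
    using Min_in[OF fin ne] unfolding min_nonzero_eigenvalue_def by auto
  show "eigenvalue L x \<Longrightarrow> x \<noteq> 0 \<Longrightarrow> min_nonzero_eigenvalue L \<le> x"
    unfolding min_nonzero_eigenvalue_def by (rule Min_le[OF fin]) simp
qed

end

section \<open>The closed loop\<close>

lemma smult_add_rearrange:
  fixes A B :: "'a :: comm_ring_1 mat"
  assumes "A \<in> carrier_mat n m" "B \<in> carrier_mat n m"
  shows "c \<cdot>\<^sub>m A + r \<cdot>\<^sub>m B + t \<cdot>\<^sub>m A = r \<cdot>\<^sub>m B + (c + t) \<cdot>\<^sub>m A"
  by (rule eq_matI) (use assms in \<open>auto simp: algebra_simps\<close>)

context connected_weighted_graph
begin

abbreviation J :: "real mat" where "J \<equiv> averaging_matrix n"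

abbreviation \<Phi> :: "real mat" where "\<Phi> \<equiv> consensus_error_matrix n"

lemma consensus_error_products:
  "\<Phi> * J = 0\<^sub>m n n" "J * \<Phi> = 0\<^sub>m n n" "\<Phi> * \<Phi> = \<Phi>" "\<Phi> * L = L" "L * \<Phi> = L"
proof -
  show 1: "\<Phi> * J = 0\<^sub>m n n"
    unfolding consensus_error_matrix_eq
    by (subst minus_mult_distrib_mat[of _ n n _ _ n]) (auto simp: averaging_matrix_idem)
  show "J * \<Phi> = 0\<^sub>m n n"
    unfolding consensus_error_matrix_eq
    by (subst mult_minus_distrib_mat[of _ n n _ n]) (auto simp: averaging_matrix_idem)
  have "\<Phi> * \<Phi> = \<Phi> * 1\<^sub>m n - \<Phi> * J"
    by (subst (2) consensus_error_matrix_eq, subst mult_minus_distrib_mat[of _ n n _ n]) auto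
  then show "\<Phi> * \<Phi> = \<Phi>" unfolding 1 by (auto intro!: eq_matI)
  show "\<Phi> * L = L"
    unfolding consensus_error_matrix_eq
    by (subst minus_mult_distrib_mat[of _ n n _ _ n]) (auto simp: averaging_L)
  show "L * \<Phi> = L"
    unfolding consensus_error_matrix_eq
    by (subst mult_minus_distrib_mat[of _ n n _ n]) (auto simp: L_averaging)
qed

text \<open>The last summand makes the pencil the identity on constant vectors, so that it is invertible
  wherever \<open>p + q x \<noteq> 0\<close> for all non-zero eigenvalues \<open>x\<close> of \<open>L\<close>.\<close>

definition pencil :: "(real \<Rightarrow> 'a :: comm_ring_1) \<Rightarrow> 'a \<Rightarrow> 'a \<Rightarrow> 'a mat" where
  "pencil h p q = p \<cdot>\<^sub>m map_mat h \<Phi> + q \<cdot>\<^sub>m map_mat h L + map_mat h J"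

lemma pencil_carrier [simp]: "pencil h p q \<in> carrier_mat n n"
  by (simp add: pencil_def)

text \<open>Division-free form of det K times K^-1 \<Phi>, which makes sense over the polynomial
  ring.\<close>

definition pencil_adj :: "(real \<Rightarrow> 'a :: comm_ring_1) \<Rightarrow> 'a \<Rightarrow> 'a \<Rightarrow> 'a mat" where
  "pencil_adj h p q = adj_mat (pencil h p q) * map_mat h \<Phi>"

lemma pencil_adj_carrier [simp]: "pencil_adj h p q \<in> carrier_mat n n"
  using adj_mat(1)[OF pencil_carrier[of h p q]] by (simp add: pencil_adj_def)

context
  fixes h :: "real \<Rightarrow> 'a :: comm_ring_1"
  assumes hom: "comm_ring_hom h"
begin

interpretation h: comm_ring_hom h by (rule hom)

text \<open>The homomorphism stays arbitrary because the algebra is used with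
  \<open>const_poly\<close>, before s is fixed, and with \<open>complex_of_real\<close>, after
  evaluation.\<close>

lemma hom_products:
  "map_mat h \<Phi> * map_mat h J = 0\<^sub>m n n"
  "map_mat h J * map_mat h \<Phi> = 0\<^sub>m n n"
  "map_mat h \<Phi> * map_mat h \<Phi> = map_mat h \<Phi>"
  "map_mat h \<Phi> * map_mat h L = map_mat h L"
  "map_mat h L * map_mat h \<Phi> = map_mat h L"
  "map_mat h L * map_mat h J = 0\<^sub>m n n"
  "map_mat h J * map_mat h L = 0\<^sub>m n n"
  "map_mat h J * map_mat h J = map_mat h J"
  "map_mat h \<Phi> = 1\<^sub>m n - map_mat h J"
proof -
  have 0: "map_mat h (0\<^sub>m n n) = 0\<^sub>m n n" by (rule eq_matI) auto
  note m = h.mat_hom_mult[of _ n n _ n, symmetric]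
  show "map_mat h \<Phi> * map_mat h J = 0\<^sub>m n n"
    "map_mat h J * map_mat h \<Phi> = 0\<^sub>m n n"
    "map_mat h \<Phi> * map_mat h \<Phi> = map_mat h \<Phi>"
    "map_mat h \<Phi> * map_mat h L = map_mat h L"
    "map_mat h L * map_mat h \<Phi> = map_mat h L"
    "map_mat h L * map_mat h J = 0\<^sub>m n n"
    "map_mat h J * map_mat h L = 0\<^sub>m n n"
    "map_mat h J * map_mat h J = map_mat h J"
    by (simp_all add: m consensus_error_products L_averaging averaging_L averaging_matrix_idem 0)
  show "map_mat h \<Phi> = 1\<^sub>m n - map_mat h J"
    by (rule eq_matI) (auto simp: consensus_error_matrix_eq averaging_matrix_def hom_distribs)
qed

lemma pencil_products:
  "pencil h p q * map_mat h J = map_mat h J"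
  "map_mat h J * pencil h p q = map_mat h J"
  "pencil h p q * map_mat h \<Phi> = p \<cdot>\<^sub>m map_mat h \<Phi> + q \<cdot>\<^sub>m map_mat h L"
  "map_mat h \<Phi> * pencil h p q = p \<cdot>\<^sub>m map_mat h \<Phi> + q \<cdot>\<^sub>m map_mat h L"
  unfolding pencil_def
  by (simp_all add: add_mult_distrib_mat[of _ n n _ _ n] mult_add_distrib_mat[of _ n n _ n]
    mult_smult_distrib[of _ n n _ n] mult_smult_assoc_mat[of _ n n _ n] hom_products(1-8))

text \<open>All five follow from the adjugate identities, since the pencil commutes with \<Phi> and
  fixes \<open>J\<close>. The first has the shape that the closed-loop equation requires; the others
  survive evaluation and make the quotient by the determinant an inverse on zero-sum
  vectors.\<close>

lemma pencil_adj_products: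
  defines "N \<equiv> \<lambda>p q. pencil_adj h p q" and "d \<equiv> \<lambda>p q. det (pencil h p q)"
  shows "p \<cdot>\<^sub>m N p q + q \<cdot>\<^sub>m (map_mat h L * N p q) = d p q \<cdot>\<^sub>m map_mat h \<Phi>"
    and "N p q * pencil h p q = d p q \<cdot>\<^sub>m map_mat h \<Phi>"
    and "pencil h p q * N p q = d p q \<cdot>\<^sub>m map_mat h \<Phi>"
    and "map_mat h J * N p q = 0\<^sub>m n n"
    and "N p q * map_mat h J = 0\<^sub>m n n"
proof -
  let ?K = "pencil h p q" and ?A = "adj_mat (pencil h p q)"
  note A = adj_mat[OF pencil_carrier[of h p q]]
  have Nc: "N p q \<in> carrier_mat n n" by (simp add: N_def)
  show KN: "?K * N p q = d p q \<cdot>\<^sub>m map_mat h \<Phi>"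
    unfolding N_def pencil_adj_def
    by (subst assoc_mult_mat[of _ n n _ n _ n, symmetric])
      (use A in \<open>auto simp: d_def mult_smult_assoc_mat[of _ n n _ n]\<close>)
  have "N p q * ?K = ?A * (map_mat h \<Phi> * ?K)"
    unfolding N_def pencil_adj_def by (subst assoc_mult_mat[of _ n n _ n _ n]) (use A in auto)
  also have "\<dots> = ?A * (?K * map_mat h \<Phi>)" by (simp add: pencil_products)
  also have "\<dots> = d p q \<cdot>\<^sub>m map_mat h \<Phi>"
    by (subst assoc_mult_mat[of _ n n _ n _ n, symmetric])
      (use A in \<open>auto simp: d_def mult_smult_assoc_mat[of _ n n _ n]\<close>)
  finally show "N p q * ?K = d p q \<cdot>\<^sub>m map_mat h \<Phi>" .
  \<comment> \<open>Since J K = J, the product J N equals J K N, a multiple of J \<Phi> = 0.\<close>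
  have "map_mat h J * N p q = map_mat h J * ?K * N p q" by (simp add: pencil_products)
  also have "\<dots> = map_mat h J * (?K * N p q)"
    by (rule assoc_mult_mat[of _ n n _ n _ n]) (use Nc in auto)
  also have "\<dots> = 0\<^sub>m n n"
    unfolding KN by (auto simp: mult_smult_distrib[of _ n n _ n] hom_products(1-8))
  finally show PN: "map_mat h J * N p q = 0\<^sub>m n n" .
  show "N p q * map_mat h J = 0\<^sub>m n n"
    unfolding N_def pencil_adj_def
    by (subst assoc_mult_mat[of _ n n _ n _ n]) (use A in \<open>auto simp: hom_products(1-8)\<close>)
  have "map_mat h \<Phi> * N p q = N p q"
    unfolding hom_products(9) using Nc PN
    by (subst minus_mult_distrib_mat[of _ n n _ _ n]) auto
  moreover have c: "p \<cdot>\<^sub>m N p q + q \<cdot>\<^sub>m (map_mat h L * N p q) \<in> carrier_mat n n"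
    using Nc by (intro add_carrier_mat smult_carrier_mat mult_carrier_mat[of _ n n]) auto
  ultimately have "?K * N p q = p \<cdot>\<^sub>m N p q + q \<cdot>\<^sub>m (map_mat h L * N p q)"
    unfolding pencil_def using Nc PN
    by (simp add: add_mult_distrib_mat[of _ n n _ _ n] mult_smult_assoc_mat[of _ n n _ n])
  then show "p \<cdot>\<^sub>m N p q + q \<cdot>\<^sub>m (map_mat h L * N p q) = d p q \<cdot>\<^sub>m map_mat h \<Phi>"
    using KN by simp
qed

end

lemma output_state_commute:
  assumes "M \<in> carrier_mat n n" "\<Phi> * M = M * \<Phi>"
  shows "output_matrix n * state_matrix n \<alpha> \<beta> L M = state_matrix n \<alpha> \<beta> L M * output_matrix n"
  unfolding output_matrix_def state_matrix_def
  using assms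
  by (simp add: mult_four_block_mat[of _ n n _ n _ n _ _ n _ n]
      mult_smult_distrib[of _ n n _ n] mult_smult_assoc_mat[of _ n n _ n] consensus_error_products)

lemma output_input: "output_matrix n * input_matrix n = 0\<^sub>m n n @\<^sub>r \<Phi>"
  unfolding output_matrix_def input_matrix_def append_rows_def
  by (simp add: mult_four_block_mat[of _ n n _ n _ n _ _ n _ 0])

text \<open>\<open>N\<close> is the position response and s \<open>N\<close> the velocity response.
  The upper block row then cancels, and the lower one becomes the second-order equation whose
  coefficients are those of the pencil.\<close>

lemma closed_loop_equation:
  fixes N :: "complex poly mat"
  assumes N: "N \<in> carrier_mat n n"
    and eq: "[:0, of_real (\<beta> * a), 1:] \<cdot>\<^sub>m N + [:of_real \<alpha>, of_real (\<beta> * b):] \<cdot>\<^sub>m (map_mat const_poly L * N)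
      = d \<cdot>\<^sub>m map_mat const_poly \<Phi>"
  shows "([:0, 1:] \<cdot>\<^sub>m 1\<^sub>m (n + n)
      - map_mat const_poly (state_matrix n \<alpha> \<beta> L (a \<cdot>\<^sub>m 1\<^sub>m n + b \<cdot>\<^sub>m L))) * (N @\<^sub>r [:0, 1:] \<cdot>\<^sub>m N)
    = d \<cdot>\<^sub>m map_mat const_poly (output_matrix n * input_matrix n)"
proof -
  let ?s = "[:0, 1:] :: complex poly" and ?L = "map_mat const_poly L"
  let ?c = const_poly
  have 1: "?s \<cdot>\<^sub>m 1\<^sub>m (n + n) - map_mat ?c (state_matrix n \<alpha> \<beta> L (a \<cdot>\<^sub>m 1\<^sub>m n + b \<cdot>\<^sub>m L))
    = four_block_mat (?s \<cdot>\<^sub>m 1\<^sub>m n) (- 1\<^sub>m n) (?c \<alpha> \<cdot>\<^sub>m ?L)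
        ((?s + ?c (\<beta> * a)) \<cdot>\<^sub>m 1\<^sub>m n + ?c (\<beta> * b) \<cdot>\<^sub>m ?L)" (is "?E = _")
    by (rule eq_matI) (auto simp: state_matrix_def const_poly_def algebra_simps one_pCons)
  have LN: "?L * N \<in> carrier_mat n n" using N by (intro mult_carrier_mat[of _ n n]) auto
  have 2: "?E * (N @\<^sub>r ?s \<cdot>\<^sub>m N)
    = (?s \<cdot>\<^sub>m N + - (?s \<cdot>\<^sub>m N)) @\<^sub>r
      (?c \<alpha> \<cdot>\<^sub>m (?L * N) + (?s * (?s + ?c (\<beta> * a))) \<cdot>\<^sub>m N + (?s * ?c (\<beta> * b)) \<cdot>\<^sub>m (?L * N))"
    unfolding 1 append_rows_def using N LN
    by (subst mult_four_block_mat[of _ n n _ n _ n _ _ n _ 0])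
      (auto simp: mult_smult_distrib[of _ n n _ n] mult_smult_assoc_mat[of _ n n _ n]
        add_mult_distrib_mat[of _ n n _ _ n])
  have 3: "?s \<cdot>\<^sub>m N + - (?s \<cdot>\<^sub>m N) = 0\<^sub>m n n" using N by (intro eq_matI) auto
  have "?c \<alpha> \<cdot>\<^sub>m (?L * N) + (?s * (?s + ?c (\<beta> * a))) \<cdot>\<^sub>m N + (?s * ?c (\<beta> * b)) \<cdot>\<^sub>m (?L * N)
      = [:0, of_real (\<beta> * a), 1:] \<cdot>\<^sub>m N + [:of_real \<alpha>, of_real (\<beta> * b):] \<cdot>\<^sub>m (?L * N)"
  proof -
    have p: "[:0, of_real (\<beta> * a), 1:] = ?s * (?s + ?c (\<beta> * a))"
      "[:of_real \<alpha>, of_real (\<beta> * b):] = ?c \<alpha> + ?s * ?c (\<beta> * b)"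
      by (simp_all add: const_poly_def)
    show ?thesis unfolding p by (rule smult_add_rearrange[OF LN N])
  qed
  then have 4: "?c \<alpha> \<cdot>\<^sub>m (?L * N) + (?s * (?s + ?c (\<beta> * a))) \<cdot>\<^sub>m N + (?s * ?c (\<beta> * b)) \<cdot>\<^sub>m (?L * N)
      = d \<cdot>\<^sub>m map_mat ?c \<Phi>" using eq by simp
  have "?E * (N @\<^sub>r ?s \<cdot>\<^sub>m N) = 0\<^sub>m n n @\<^sub>r d \<cdot>\<^sub>m map_mat ?c \<Phi>"
    unfolding 2 3 4 ..
  also have "\<dots> = d \<cdot>\<^sub>m map_mat ?c (0\<^sub>m n n @\<^sub>r \<Phi>)"
    by (rule eq_matI) (auto simp: append_rows_def)
  finally show ?thesis unfolding output_input .
qed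

end

section \<open>Singular values\<close>

lemma mat_adjoint_index:
  "i < dim_col A \<Longrightarrow> j < dim_row A \<Longrightarrow> mat_adjoint A $$ (i, j) = conjugate (A $$ (j, i))"
  by (simp add: mat_adjoint_def mat_of_rows_index)

lemma mat_adjoint_dim [simp]: "dim_row (mat_adjoint A) = dim_col A" "dim_col (mat_adjoint A) = dim_row A"
  by (simp_all add: mat_adjoint_def)

lemma mat_adjoint_carrier: "A \<in> carrier_mat n m \<Longrightarrow> mat_adjoint A \<in> carrier_mat m n"
  by auto

lemma mat_adjoint_mult:
  fixes A B :: "complex mat"
  assumes "A \<in> carrier_mat n m" "B \<in> carrier_mat m k"
  shows "mat_adjoint (A * B) = mat_adjoint B * mat_adjoint A"
  by (rule eq_matI)
    (use assms in \<open>auto simp: mat_adjoint_index scalar_prod_def mult.commute intro!: sum.cong\<close>)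

text \<open>Velocity outputs are \<open>z\<close> times position outputs, so stacking them only
  rescales the Gram matrix. At z = i v the factor is the numerator 1 + v^2 of the mode gain.\<close>

lemma mat_adjoint_append_smult:
  fixes Y :: "complex mat"
  assumes Y: "Y \<in> carrier_mat n m"
  shows "mat_adjoint (Y @\<^sub>r z \<cdot>\<^sub>m Y) * (Y @\<^sub>r z \<cdot>\<^sub>m Y) = of_real (1 + (cmod z)\<^sup>2) \<cdot>\<^sub>m (mat_adjoint Y * Y)"
proof (rule eq_matI)
  let ?T = "Y @\<^sub>r z \<cdot>\<^sub>m Y"
  fix i j assume "i < dim_row (of_real (1 + (cmod z)\<^sup>2) \<cdot>\<^sub>m (mat_adjoint Y * Y))"
    "j < dim_col (of_real (1 + (cmod z)\<^sup>2) \<cdot>\<^sub>m (mat_adjoint Y * Y))"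
  then have ij: "i < m" "j < m" using Y by auto
  have T: "?T \<in> carrier_mat (n + n) m" using Y by auto
  have "(mat_adjoint ?T * ?T) $$ (i, j) = (\<Sum>k<n+n. cnj (?T $$ (k, i)) * ?T $$ (k, j))"
    using ij T by (auto simp: scalar_prod_def mat_adjoint_index atLeast0LessThan intro!: sum.cong)
  also have "\<dots> = (\<Sum>k<n. cnj (?T $$ (k, i)) * ?T $$ (k, j))
      + (\<Sum>k<n. cnj (?T $$ (n + k, i)) * ?T $$ (n + k, j))"
    by (simp add: lessThan_atLeast0 sum.nat_group sum.atLeastLessThan_concat[of 0 n "n + n", symmetric]
        sum.shift_bounds_nat_ivl[of _ 0 n n, simplified]) (simp add: add.commute)
  also have "\<dots> = (\<Sum>k<n. cnj (Y $$ (k, i)) * Y $$ (k, j))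
      + (\<Sum>k<n. cnj (z * Y $$ (k, i)) * (z * Y $$ (k, j)))"
    using ij Y by (auto simp: append_rows_def intro!: arg_cong2[of _ _ _ _ "(+)"] sum.cong)
  also have "\<dots> = of_real (1 + (cmod z)\<^sup>2) * (\<Sum>k<n. cnj (Y $$ (k, i)) * Y $$ (k, j))"
    unfolding sum_distrib_left sum.distrib[symmetric] of_real_add complex_norm_square
    by (intro sum.cong refl) (simp add: algebra_simps)
  also have "(\<Sum>k<n. cnj (Y $$ (k, i)) * Y $$ (k, j)) = (mat_adjoint Y * Y) $$ (i, j)"
    using ij Y by (auto simp: scalar_prod_def mat_adjoint_index atLeast0LessThan intro!: sum.cong)
  finally show "(mat_adjoint ?T * ?T) $$ (i, j)
    = (of_real (1 + (cmod z)\<^sup>2) \<cdot>\<^sub>m (mat_adjoint Y * Y)) $$ (i, j)" using ij Y by simp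
qed (use Y in \<open>auto simp: append_rows_def\<close>)

text \<open>Factor the annihilator as a (M - r1) (M - r2). Either \<open>x\<close> is already an
  eigenvector for r2, or (M - r2) x is a non-zero one for r1. The explicit combination of
  \<open>x\<close> and \<open>M *\<^sub>v x\<close> is kept so that properties of both, such as zero
  sum, pass to the eigenvector.\<close>

lemma quadratic_annihilator_eigenvector:
  fixes M :: "complex mat"
  assumes M: "M \<in> carrier_mat n n" and x: "x \<in> carrier_vec n" "x \<noteq> 0\<^sub>v n" and a: "a \<noteq> 0"
    and zero: "a \<cdot>\<^sub>v (M *\<^sub>v (M *\<^sub>v x)) + b \<cdot>\<^sub>v (M *\<^sub>v x) + c \<cdot>\<^sub>v x = 0\<^sub>v n"
  obtains r s t where "s \<cdot>\<^sub>v x + t \<cdot>\<^sub>v (M *\<^sub>v x) \<noteq> 0\<^sub>v n"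
    "M *\<^sub>v (s \<cdot>\<^sub>v x + t \<cdot>\<^sub>v (M *\<^sub>v x)) = r \<cdot>\<^sub>v (s \<cdot>\<^sub>v x + t \<cdot>\<^sub>v (M *\<^sub>v x))"
    "a * r\<^sup>2 + b * r + c = 0"
proof -
  define w where "w = csqrt (b\<^sup>2 - 4 * a * c)"
  have w: "w\<^sup>2 = b\<^sup>2 - 4 * a * c" by (simp add: w_def)
  define r1 where "r1 = (- b + w) / (2 * a)"
  define r2 where "r2 = (- b - w) / (2 * a)"
  have b: "b = - a * (r1 + r2)" using a by (simp add: r1_def r2_def field_simps)
  have "a * r1 * r2 = (- b + w) * (- b - w) / (4 * a)" using a by (simp add: r1_def r2_def)
  also have "(- b + w) * (- b - w) = b\<^sup>2 - w\<^sup>2" by (simp add: algebra_simps power2_eq_square)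
  also have "\<dots> / (4 * a) = c" using a by (simp add: w)
  finally have c: "c = a * r1 * r2" by simp
  have roots: "a * r1\<^sup>2 + b * r1 + c = 0" "a * r2\<^sup>2 + b * r2 + c = 0"
    unfolding b c by (simp_all add: algebra_simps power2_eq_square)
  have Mx: "M *\<^sub>v x \<in> carrier_vec n" and MMx: "M *\<^sub>v (M *\<^sub>v x) \<in> carrier_vec n" using M x by auto
  have comp: "(M *\<^sub>v (M *\<^sub>v x)) $ i = (r1 + r2) * (M *\<^sub>v x) $ i - r1 * r2 * x $ i" if "i < n" for i
  proof -
    have "(a \<cdot>\<^sub>v (M *\<^sub>v (M *\<^sub>v x)) + b \<cdot>\<^sub>v (M *\<^sub>v x) + c \<cdot>\<^sub>v x) $ i = 0"
      unfolding zero using that by simp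
    then have "a * (M *\<^sub>v (M *\<^sub>v x)) $ i + b * (M *\<^sub>v x) $ i + c * x $ i = 0"
      using that Mx MMx x M by (simp add: add.assoc del: index_mult_mat_vec)
    then have "a * ((M *\<^sub>v (M *\<^sub>v x)) $ i - (r1 + r2) * (M *\<^sub>v x) $ i + r1 * r2 * x $ i) = 0"
      unfolding b c by (simp add: algebra_simps del: index_mult_mat_vec)
    then have "(M *\<^sub>v (M *\<^sub>v x)) $ i - (r1 + r2) * (M *\<^sub>v x) $ i + r1 * r2 * x $ i = 0"
      using a by (simp del: index_mult_mat_vec)
    then show ?thesis by (simp add: algebra_simps del: index_mult_mat_vec)
  qed
  have comb: "M *\<^sub>v (s \<cdot>\<^sub>v x + t \<cdot>\<^sub>v (M *\<^sub>v x)) = s \<cdot>\<^sub>v (M *\<^sub>v x) + t \<cdot>\<^sub>v (M *\<^sub>v (M *\<^sub>v x))" for s t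
    using x Mx by (simp add: mult_add_distrib_mat_vec[OF M] mult_mat_vec[OF M])
  show thesis
  proof (cases "M *\<^sub>v x = r2 \<cdot>\<^sub>v x")
    case True
    have x1: "1 \<cdot>\<^sub>v x + 0 \<cdot>\<^sub>v (M *\<^sub>v x) = x" using x Mx M by (intro eq_vecI) auto
    show thesis by (rule that[of 1 0 r2]) (unfold x1, use x True roots in auto)
  next
    case False
    show thesis
    proof (rule that[of "- r2" 1 r1])
      show "- r2 \<cdot>\<^sub>v x + 1 \<cdot>\<^sub>v (M *\<^sub>v x) \<noteq> 0\<^sub>v n"
      proof
        assume 0: "- r2 \<cdot>\<^sub>v x + 1 \<cdot>\<^sub>v (M *\<^sub>v x) = 0\<^sub>v n"
        have "(M *\<^sub>v x) $ i = r2 * x $ i" if "i < n" for i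
          using arg_cong[OF 0, of "\<lambda>v. v $ i"] that x M by (simp del: index_mult_mat_vec)
        then have "M *\<^sub>v x = r2 \<cdot>\<^sub>v x"
          using x M by (intro eq_vecI) (simp_all del: index_mult_mat_vec)
        then show False using False by simp
      qed
      show "M *\<^sub>v (- r2 \<cdot>\<^sub>v x + 1 \<cdot>\<^sub>v (M *\<^sub>v x)) = r1 \<cdot>\<^sub>v (- r2 \<cdot>\<^sub>v x + 1 \<cdot>\<^sub>v (M *\<^sub>v x))"
        unfolding comb
      proof (rule eq_vecI)
        fix i assume "i < dim_vec (r1 \<cdot>\<^sub>v (- r2 \<cdot>\<^sub>v x + 1 \<cdot>\<^sub>v (M *\<^sub>v x)))"
        then have i: "i < n" using M by simp
        show "(- r2 \<cdot>\<^sub>v (M *\<^sub>v x) + 1 \<cdot>\<^sub>v (M *\<^sub>v (M *\<^sub>v x))) $ i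
          = (r1 \<cdot>\<^sub>v (- r2 \<cdot>\<^sub>v x + 1 \<cdot>\<^sub>v (M *\<^sub>v x))) $ i"
          using comp[OF i] i x M by (simp add: algebra_simps del: index_mult_mat_vec)
      qed (use M in auto)
    qed (rule roots)
  qed
qed

section \<open>Spectrum of the Gram matrix in terms of the spectrum of the Laplacian\<close>

context connected_weighted_graph
begin

abbreviation Jc :: "complex mat" where "Jc \<equiv> map_mat complex_of_real J"

abbreviation \<Phi>c :: "complex mat" where "\<Phi>c \<equiv> map_mat complex_of_real \<Phi>"

lemma comm_ring_hom_of_real: "comm_ring_hom complex_of_real"
  by unfold_locales

lemma Jc_mult_vec_zero_iff:
  assumes "v \<in> carrier_vec n"
  shows "Jc *\<^sub>v v = 0\<^sub>v n \<longleftrightarrow> (\<Sum>i<n. v $ i) = 0"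
proof
  assume *: "Jc *\<^sub>v v = 0\<^sub>v n"
  show "(\<Sum>i<n. v $ i) = 0"
    using mult_vec_averaging[OF assms, of 0] n_ge_2 unfolding * by simp
next
  assume "(\<Sum>i<n. v $ i) = 0"
  then show "Jc *\<^sub>v v = 0\<^sub>v n"
    using mult_vec_averaging[OF assms] by (intro eq_vecI) (simp_all del: index_mult_mat_vec)
qed

lemma \<Phi>c_mult_vec:
  assumes v: "v \<in> carrier_vec n" and "Jc *\<^sub>v v = 0\<^sub>v n"
  shows "\<Phi>c *\<^sub>v v = v"
  unfolding hom_products(9)[OF comm_ring_hom_of_real]
  using assms by (subst minus_mult_distrib_mat_vec[of _ n n]) auto

lemma pencil_mult_vec:
  assumes v: "v \<in> carrier_vec n" and sum: "(\<Sum>i<n. v $ i) = 0"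
  shows "pencil complex_of_real p q *\<^sub>v v = p \<cdot>\<^sub>v v + q \<cdot>\<^sub>v (Lc *\<^sub>v v)"
proof -
  have J: "Jc *\<^sub>v v = 0\<^sub>v n" using Jc_mult_vec_zero_iff[OF v] sum by simp
  have "pencil complex_of_real p q *\<^sub>v v
    = (p \<cdot>\<^sub>m \<Phi>c) *\<^sub>v v + (q \<cdot>\<^sub>m Lc) *\<^sub>v v + Jc *\<^sub>v v"
    unfolding pencil_def using v
    by (subst add_mult_distrib_mat_vec[of _ n n], auto simp: add_mult_distrib_mat_vec[of _ n n])
  also have "(p \<cdot>\<^sub>m \<Phi>c) *\<^sub>v v = p \<cdot>\<^sub>v (\<Phi>c *\<^sub>v v)" using v by (intro eq_vecI) auto
  also have "(q \<cdot>\<^sub>m Lc) *\<^sub>v v = q \<cdot>\<^sub>v (Lc *\<^sub>v v)" using v by (intro eq_vecI) auto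
  finally show ?thesis unfolding J \<Phi>c_mult_vec[OF v J] using v by (auto intro!: eq_vecI)
qed

lemma adjoint_real_symmetric:
  assumes "A \<in> carrier_mat n n" "\<And>i j. i < n \<Longrightarrow> j < n \<Longrightarrow> A $$ (i, j) = A $$ (j, i)"
  shows "mat_adjoint (map_mat complex_of_real A) = map_mat complex_of_real A"
  by (rule eq_matI) (use assms in \<open>auto simp: mat_adjoint_index\<close>)

lemma J_sym: "i < n \<Longrightarrow> j < n \<Longrightarrow> J $$ (i, j) = J $$ (j, i)"
  by (simp add: averaging_matrix_def)

lemma \<Phi>_sym: "i < n \<Longrightarrow> j < n \<Longrightarrow> \<Phi> $$ (i, j) = \<Phi> $$ (j, i)"
  by (auto simp: consensus_error_matrix_eq averaging_matrix_def)

lemma pencil_adjoint: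
  "mat_adjoint (pencil complex_of_real p q) = pencil complex_of_real (cnj p) (cnj q)"
  by (rule eq_matI)
    (auto simp: mat_adjoint_index pencil_def J_sym \<Phi>_sym L_sym)

context
  fixes p q :: complex and Y :: "complex mat" and c :: real
  assumes q: "q \<noteq> 0" and Y: "Y \<in> carrier_mat n n" and c: "c > 0"
    and YK: "Y * pencil complex_of_real p q = \<Phi>c" and KY: "pencil complex_of_real p q * Y = \<Phi>c"
    and JY: "Jc * Y = 0\<^sub>m n n" and YJ: "Y * Jc = 0\<^sub>m n n"
begin

text \<open>In the application \<open>Y\<close> is the evaluated \<open>pencil_adj\<close> divided
  by the determinant: it inverts the pencil on zero-sum vectors and annihilates constants.
  \<open>c\<close> will be 1 + v^2.\<close>

private abbreviation "G \<equiv> of_real c \<cdot>\<^sub>m (mat_adjoint Y * Y)"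

lemma gram_mult_vec:
  assumes "v \<in> carrier_vec n"
  shows "G *\<^sub>v v = of_real c \<cdot>\<^sub>v (mat_adjoint Y *\<^sub>v (Y *\<^sub>v v))"
proof -
  have "G *\<^sub>v v = of_real c \<cdot>\<^sub>v ((mat_adjoint Y * Y) *\<^sub>v v)"
    using Y assms by (intro eq_vecI) (auto simp: mat_adjoint_carrier)
  then show ?thesis using Y assms by (simp add: assoc_mult_mat_vec[OF mat_adjoint_carrier[OF Y] Y])
qed

lemma adjoint_products:
  "mat_adjoint Y * pencil complex_of_real (cnj p) (cnj q) = \<Phi>c"
  "pencil complex_of_real (cnj p) (cnj q) * mat_adjoint Y = \<Phi>c"
  "Jc * mat_adjoint Y = 0\<^sub>m n n"
proof -
  have \<Phi>': "mat_adjoint \<Phi>c = \<Phi>c" by (rule adjoint_real_symmetric) (use \<Phi>_sym in auto)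
  have J': "mat_adjoint Jc = Jc" by (rule adjoint_real_symmetric) (use J_sym in auto)
  show "mat_adjoint Y * pencil complex_of_real (cnj p) (cnj q) = \<Phi>c"
    using arg_cong[OF KY, of mat_adjoint] Y by (simp add: mat_adjoint_mult[of _ n n _ n] pencil_adjoint \<Phi>')
  show "pencil complex_of_real (cnj p) (cnj q) * mat_adjoint Y = \<Phi>c"
    using arg_cong[OF YK, of mat_adjoint] Y by (simp add: mat_adjoint_mult[of _ n n _ n] pencil_adjoint \<Phi>')
  have "mat_adjoint (0\<^sub>m n n :: complex mat) = 0\<^sub>m n n" by (rule eq_matI) (auto simp: mat_adjoint_index)
  then show "Jc * mat_adjoint Y = 0\<^sub>m n n"
    using arg_cong[OF YJ, of mat_adjoint] Y by (simp add: mat_adjoint_mult[of _ n n _ n] J')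
qed

text \<open>On \<open>v\<close> the pencil acts as a scalar, and \<open>Z\<close> undoes it up to
  \<Phi>, which fixes \<open>v\<close>. \<open>Z\<close> is general in order to cover both
  \<open>Y\<close> and its adjoint, whose pencil has conjugate coefficients.\<close>

lemma left_inverse_eigenvector:
  assumes Z: "Z \<in> carrier_mat n n" and ZK: "Z * pencil complex_of_real u w = \<Phi>c"
    and v: "v \<in> carrier_vec n" "(\<Sum>i<n. v $ i) = 0" "Lc *\<^sub>v v = of_real x \<cdot>\<^sub>v v"
    and k: "u + w * of_real x \<noteq> 0"
  shows "Z *\<^sub>v v = (1 / (u + w * of_real x)) \<cdot>\<^sub>v v"
proof -
  have "pencil complex_of_real u w *\<^sub>v v = (u + w * of_real x) \<cdot>\<^sub>v v"
    unfolding pencil_mult_vec[OF v(1,2)] v(3) using v(1) by (intro eq_vecI) (auto simp: algebra_simps)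
  then have "(u + w * of_real x) \<cdot>\<^sub>v (Z *\<^sub>v v) = Z *\<^sub>v (pencil complex_of_real u w *\<^sub>v v)"
    using Z v by (simp add: mult_mat_vec[OF Z])
  also have "\<dots> = \<Phi>c *\<^sub>v v"
    unfolding ZK[symmetric] by (rule assoc_mult_mat_vec[symmetric]) (use Z v in auto)
  also have "\<dots> = v" by (rule \<Phi>c_mult_vec) (use v Jc_mult_vec_zero_iff in auto)
  finally have eq: "(u + w * of_real x) \<cdot>\<^sub>v (Z *\<^sub>v v) = v" .
  have "(1 / (u + w * of_real x)) \<cdot>\<^sub>v ((u + w * of_real x) \<cdot>\<^sub>v (Z *\<^sub>v v)) = Z *\<^sub>v v"
    using k by (simp add: smult_smult_assoc)
  then show ?thesis unfolding eq by simp
qed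

lemma eigenvalue_gramI:
  assumes ev: "eigenvalue L x" "x \<noteq> 0" and k: "p + q * of_real x \<noteq> 0"
  shows "eigenvalue G (of_real (c / (cmod (p + q * of_real x))\<^sup>2))"
proof -
  obtain v where v: "v \<in> carrier_vec n" "v \<noteq> 0\<^sub>v n" "Lc *\<^sub>v v = of_real x \<cdot>\<^sub>v v" "(\<Sum>i<n. v $ i) = 0"
    using eigenvalue_L_vec[OF ev] by blast
  let ?k = "p + q * of_real x"
  have k': "cnj p + cnj q * of_real x = cnj ?k" by simp
  have "Y *\<^sub>v v = (1 / ?k) \<cdot>\<^sub>v v"
    by (rule left_inverse_eigenvector[OF Y YK v(1,4,3) k])
  moreover have "mat_adjoint Y *\<^sub>v v = (1 / cnj ?k) \<cdot>\<^sub>v v"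
    unfolding k'[symmetric]
    by (rule left_inverse_eigenvector[OF mat_adjoint_carrier[OF Y] adjoint_products(1) v(1,4,3)])
      (use k in \<open>simp only: k' complex_cnj_zero_iff not_False_eq_True\<close>)
  ultimately have "G *\<^sub>v v = of_real c \<cdot>\<^sub>v ((1 / ?k) \<cdot>\<^sub>v ((1 / cnj ?k) \<cdot>\<^sub>v v))"
    using v by (simp only: gram_mult_vec[OF v(1)] mult_mat_vec[OF mat_adjoint_carrier[OF Y] v(1)])
  also have "\<dots> = of_real (c / (cmod ?k)\<^sup>2) \<cdot>\<^sub>v v"
    by (simp only: smult_smult_assoc of_real_divide complex_norm_square) simp
  finally show ?thesis using v Y by (auto simp: eigenvalue_def eigenvector_def)
qed

text \<open>The value 0 must be excluded: constant vectors lie in the kernel of \<open>G\<close> but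
  belong to no mode. For \<mu> non-zero, multiplying the eigenvector equation by \<open>Jc\<close>,
  by the adjoint pencil and by the pencil removes \<open>Y\<close> altogether.\<close>

lemma eigenvalue_gramD:
  assumes ev: "eigenvalue G (of_real \<mu>)" and \<mu>: "\<mu> \<noteq> 0"
  shows "\<exists>x. eigenvalue L x \<and> x \<noteq> 0 \<and> \<mu> * (cmod (p + q * of_real x))\<^sup>2 = c"
proof -
  obtain x where x: "x \<in> carrier_vec n" "x \<noteq> 0\<^sub>v n" "G *\<^sub>v x = of_real \<mu> \<cdot>\<^sub>v x"
    using ev Y by (auto simp: eigenvalue_def eigenvector_def)
  let ?K = "pencil complex_of_real p q" and ?K' = "pencil complex_of_real (cnj p) (cnj q)"
  have Y': "mat_adjoint Y \<in> carrier_mat n n" by (rule mat_adjoint_carrier[OF Y])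
  have Yx: "Y *\<^sub>v x \<in> carrier_vec n" and YYx: "mat_adjoint Y *\<^sub>v (Y *\<^sub>v x) \<in> carrier_vec n"
    using Y Y' x by auto
  have eq: "of_real \<mu> \<cdot>\<^sub>v x = of_real c \<cdot>\<^sub>v (mat_adjoint Y *\<^sub>v (Y *\<^sub>v x))"
    using x gram_mult_vec by simp
  have apply_eq: "of_real \<mu> \<cdot>\<^sub>v (M *\<^sub>v x) = of_real c \<cdot>\<^sub>v ((M * mat_adjoint Y) *\<^sub>v (Y *\<^sub>v x))"
    if M: "M \<in> carrier_mat n n" for M
  proof -
    have "of_real \<mu> \<cdot>\<^sub>v (M *\<^sub>v x) = M *\<^sub>v (of_real \<mu> \<cdot>\<^sub>v x)" using M x by (simp add: mult_mat_vec)
    also have "\<dots> = of_real c \<cdot>\<^sub>v (M *\<^sub>v (mat_adjoint Y *\<^sub>v (Y *\<^sub>v x)))"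
      unfolding eq using M YYx by (simp add: mult_mat_vec)
    finally show ?thesis using M Y' Yx by (simp add: assoc_mult_mat_vec[OF M Y'])
  qed
  have "of_real \<mu> \<cdot>\<^sub>v (Jc *\<^sub>v x) = 0\<^sub>v n"
    using apply_eq[of Jc] Yx by (simp add: adjoint_products(3)) (auto intro!: eq_vecI)
  then have Jx: "Jc *\<^sub>v x = 0\<^sub>v n"
    using \<mu> by (auto simp: vec_eq_iff simp del: index_mult_mat_vec)
  then have sx: "(\<Sum>i<n. x $ i) = 0" using Jc_mult_vec_zero_iff[OF x(1)] by simp
  have JYx: "Jc *\<^sub>v (Y *\<^sub>v x) = 0\<^sub>v n"
  proof -
    have "Jc *\<^sub>v (Y *\<^sub>v x) = (Jc * Y) *\<^sub>v x"
      by (rule assoc_mult_mat_vec[symmetric]) (use Y x in auto)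
    then show ?thesis unfolding JY using x by (auto intro!: eq_vecI)
  qed
  have K'x: "of_real \<mu> \<cdot>\<^sub>v (?K' *\<^sub>v x) = of_real c \<cdot>\<^sub>v (Y *\<^sub>v x)"
    using apply_eq[of ?K'] by (simp add: adjoint_products(2) \<Phi>c_mult_vec[OF Yx JYx])
  have K'c: "?K' *\<^sub>v x \<in> carrier_vec n" using mult_mat_vec_carrier[OF pencil_carrier x(1)] .
  have "of_real \<mu> \<cdot>\<^sub>v (?K *\<^sub>v (?K' *\<^sub>v x)) = ?K *\<^sub>v (of_real \<mu> \<cdot>\<^sub>v (?K' *\<^sub>v x))"
    using mult_mat_vec[OF pencil_carrier K'c] by simp
  also have "\<dots> = of_real c \<cdot>\<^sub>v (?K *\<^sub>v (Y *\<^sub>v x))"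
    unfolding K'x using mult_mat_vec[OF pencil_carrier Yx] by simp
  also have "?K *\<^sub>v (Y *\<^sub>v x) = (?K * Y) *\<^sub>v x"
    by (rule assoc_mult_mat_vec[OF pencil_carrier Y x(1), symmetric])
  also have "\<dots> = x" unfolding KY by (rule \<Phi>c_mult_vec[OF x(1) Jx])
  finally have KK: "of_real \<mu> \<cdot>\<^sub>v (?K *\<^sub>v (?K' *\<^sub>v x)) = of_real c \<cdot>\<^sub>v x" .
  let ?Lx = "Lc *\<^sub>v x"
  have Lx: "?Lx \<in> carrier_vec n" by (rule mult_mat_vec_carrier[OF _ x(1)]) simp
  have LLx: "Lc *\<^sub>v ?Lx \<in> carrier_vec n" by (rule mult_mat_vec_carrier[OF _ Lx]) simp
  have sLx: "(\<Sum>i<n. ?Lx $ i) = 0" by (rule sum_Lc_mult_vec[OF x(1)])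
  define u where "u = cnj p \<cdot>\<^sub>v x + cnj q \<cdot>\<^sub>v ?Lx"
  have u: "?K' *\<^sub>v x = u" unfolding u_def by (rule pencil_mult_vec[OF x(1) sx])
  have uc: "u \<in> carrier_vec n" using K'c u by simp
  \<comment> \<open>Needed for all combinations: once for \<open>u\<close>, where the pencil is
    expanded, and once for the eigenvector obtained at the end.\<close>
  have su: "(\<Sum>i<n. (s \<cdot>\<^sub>v x + t \<cdot>\<^sub>v ?Lx) $ i) = 0" for s t
  proof -
    have "(\<Sum>i<n. (s \<cdot>\<^sub>v x + t \<cdot>\<^sub>v ?Lx) $ i) = s * (\<Sum>i<n. x $ i) + t * (\<Sum>i<n. ?Lx $ i)"
      unfolding sum_distrib_left sum.distrib[symmetric] using x Lx
      by (intro sum.cong) (auto simp del: index_mult_mat_vec)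
    then show ?thesis unfolding sx sLx by simp
  qed
  have Lu: "Lc *\<^sub>v u = cnj p \<cdot>\<^sub>v ?Lx + cnj q \<cdot>\<^sub>v (Lc *\<^sub>v ?Lx)"
    unfolding u_def using x Lx by (simp add: mult_add_distrib_mat_vec[of _ n n] mult_mat_vec[of _ n n])
  have Ku: "?K *\<^sub>v u = p \<cdot>\<^sub>v u + q \<cdot>\<^sub>v (Lc *\<^sub>v u)"
    by (rule pencil_mult_vec[OF uc]) (unfold u_def, rule su)
  \<comment> \<open>Expansion of \<mu> (p + q L) (cnj p + cnj q L) - c applied to
    \<open>x\<close>.\<close>
  have zero: "(of_real \<mu> * (q * cnj q)) \<cdot>\<^sub>v (Lc *\<^sub>v ?Lx) + (of_real \<mu> * (p * cnj q + q * cnj p)) \<cdot>\<^sub>v ?Lx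
    + (of_real \<mu> * (p * cnj p) - of_real c) \<cdot>\<^sub>v x = 0\<^sub>v n"
  proof (rule eq_vecI)
    fix i assume "i < dim_vec (0\<^sub>v n :: complex vec)"
    then have i: "i < n" by simp
    have "of_real \<mu> * (p * (cnj p * x $ i + cnj q * ?Lx $ i) + q * (cnj p * ?Lx $ i + cnj q * (Lc *\<^sub>v ?Lx) $ i))
      = of_real c * x $ i"
      using arg_cong[OF KK[unfolded u Ku Lu], of "\<lambda>v. v $ i"] i x Lx LLx
      by (simp add: u_def del: index_mult_mat_vec)
    then show "((of_real \<mu> * (q * cnj q)) \<cdot>\<^sub>v (Lc *\<^sub>v ?Lx) + (of_real \<mu> * (p * cnj q + q * cnj p)) \<cdot>\<^sub>v ?Lx
      + (of_real \<mu> * (p * cnj p) - of_real c) \<cdot>\<^sub>v x) $ i = 0\<^sub>v n $ i"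
      using i x Lx LLx by (simp add: algebra_simps del: index_mult_mat_vec)
  qed (use x in auto)
  have Lcc: "Lc \<in> carrier_mat n n" by simp
  have lead: "of_real \<mu> * (q * cnj q) \<noteq> 0" using \<mu> q by simp
  obtain r s t where y: "s \<cdot>\<^sub>v x + t \<cdot>\<^sub>v ?Lx \<noteq> 0\<^sub>v n"
    "Lc *\<^sub>v (s \<cdot>\<^sub>v x + t \<cdot>\<^sub>v ?Lx) = r \<cdot>\<^sub>v (s \<cdot>\<^sub>v x + t \<cdot>\<^sub>v ?Lx)"
    and r: "of_real \<mu> * (q * cnj q) * r\<^sup>2 + of_real \<mu> * (p * cnj q + q * cnj p) * r
      + (of_real \<mu> * (p * cnj p) - of_real c) = 0"
    using quadratic_annihilator_eigenvector[OF Lcc x(1,2) lead zero] by metis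
  have yc: "s \<cdot>\<^sub>v x + t \<cdot>\<^sub>v ?Lx \<in> carrier_vec n" using x Lx by simp
  obtain l where l: "l > 0" "r = of_real l" "eigenvalue L l"
    using Lc_eigenvector_sum_zero_pos[OF yc y su] by auto
  \<comment> \<open>Because the root is real, the quadratic factors there into a number and its
    conjugate.\<close>
  have "of_real (\<mu> * (cmod (p + q * of_real l))\<^sup>2) = complex_of_real \<mu> * ((p + q * r) * cnj (p + q * r))"
    unfolding l(2) of_real_mult complex_norm_square ..
  also have "\<dots> = of_real \<mu> * (q * cnj q) * r\<^sup>2 + of_real \<mu> * (p * cnj q + q * cnj p) * r
      + (of_real \<mu> * (p * cnj p) - of_real c) + of_real c"
    unfolding l(2) by (simp add: algebra_simps power2_eq_square)
  also have "\<dots> = of_real c" unfolding r by simp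
  finally have "\<mu> * (cmod (p + q * of_real l))\<^sup>2 = c" by (simp only: of_real_eq_iff)
  then show ?thesis using l by auto
qed

end

end

section \<open>Gains of the modes\<close>

text \<open>Squared gain at the squared frequency \<open>w\<close> of the mode with Laplacian eigenvalue \<open>x\<close> and
  velocity feedback coefficient \<open>m\<close>.\<close>

definition mode_gain :: "real \<Rightarrow> real \<Rightarrow> real \<Rightarrow> real \<Rightarrow> real \<Rightarrow> real" where
  "mode_gain \<alpha> \<beta> m x w = (1 + w) / ((\<alpha> * x - w)\<^sup>2 + \<beta>\<^sup>2 * m\<^sup>2 * w)"

lemma mode_denominator_pos:
  fixes \<alpha> \<beta> m x w :: real
  assumes "\<alpha> > 0" "\<beta> > 0" "m > 0" "x > 0" "w \<ge> 0"
  shows "(\<alpha> * x - w)\<^sup>2 + \<beta>\<^sup>2 * m\<^sup>2 * w > 0"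
proof (cases "w = 0")
  case False
  then have "\<beta>\<^sup>2 * m\<^sup>2 * w > 0" using assms by simp
  then show ?thesis by (simp add: add_nonneg_pos)
qed (use assms in simp)

lemma mode_gain_nonneg:
  assumes "\<alpha> > 0" "\<beta> > 0" "m > 0" "x > 0" "w \<ge> 0"
  shows "mode_gain \<alpha> \<beta> m x w \<ge> 0"
  using mode_denominator_pos[OF assms] assms unfolding mode_gain_def by simp

lemma mode_gain_antimono:
  assumes "\<alpha> > 0" "\<beta> > 0" "0 < m'" "m' \<le> m" "x > 0" "w \<ge> 0"
  shows "mode_gain \<alpha> \<beta> m x w \<le> mode_gain \<alpha> \<beta> m' x w"
proof -
  have "m'\<^sup>2 \<le> m\<^sup>2" using assms by (simp add: power_mono)
  then have "\<beta>\<^sup>2 * m'\<^sup>2 * w \<le> \<beta>\<^sup>2 * m\<^sup>2 * w"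
    using assms by (intro mult_right_mono mult_left_mono) auto
  then show ?thesis unfolding mode_gain_def
    using assms mode_denominator_pos[of \<alpha> \<beta> m' x w] by (intro divide_left_mono mult_pos_pos
        mode_denominator_pos) auto
qed

text \<open>Scaling the squared frequency together with \<open>x\<close> by a factor \<open>r \<le> 1\<close> scales the resonance
  term by \<open>r\<^sup>2\<close> and the damping term by at most \<open>r\<close>, but the numerator only by at least \<open>r\<close>.\<close>

lemma mode_gain_scale:
  assumes "\<alpha> > 0" "\<beta> > 0" "0 < m'" "m' \<le> m" "x > 0" "w \<ge> 0" and r: "0 < r" "r \<le> 1"
  shows "mode_gain \<alpha> \<beta> m x w \<le> mode_gain \<alpha> \<beta> m' (r * x) (r * w)"
proof -
  let ?D = "(\<alpha> * x - w)\<^sup>2 + \<beta>\<^sup>2 * m\<^sup>2 * w"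
  let ?D' = "(\<alpha> * (r * x) - r * w)\<^sup>2 + \<beta>\<^sup>2 * m'\<^sup>2 * (r * w)"
  have D: "?D > 0" by (rule mode_denominator_pos) (use assms in auto)
  have D': "?D' > 0" by (rule mode_denominator_pos) (use assms in auto)
  have "m'\<^sup>2 \<le> m\<^sup>2" using assms by (simp add: power_mono)
  then have "\<beta>\<^sup>2 * m'\<^sup>2 * (r * w) \<le> \<beta>\<^sup>2 * m\<^sup>2 * (r * w)"
    using assms by (intro mult_right_mono mult_left_mono) auto
  moreover have "(\<alpha> * (r * x) - r * w)\<^sup>2 = r\<^sup>2 * (\<alpha> * x - w)\<^sup>2"
    by (simp add: power2_eq_square algebra_simps)
  moreover have "r\<^sup>2 * (\<alpha> * x - w)\<^sup>2 \<le> r * (\<alpha> * x - w)\<^sup>2"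
    using r by (intro mult_right_mono) (auto simp: power2_eq_square mult_left_le)
  ultimately have le: "?D' \<le> r * ?D" by (simp add: algebra_simps)
  have "(1 + w) / ?D = (r * (1 + w)) / (r * ?D)" using r by simp
  also have "\<dots> \<le> (r * (1 + w)) / ?D'"
    using le D D' r assms by (intro divide_left_mono mult_nonneg_nonneg mult_pos_pos) auto
  also have "\<dots> \<le> (1 + r * w) / ?D'"
    using D' r by (intro divide_right_mono) (auto simp: algebra_simps)
  finally show ?thesis unfolding mode_gain_def .
qed

section \<open>Singular values and norm of the closed loop on the imaginary axis\<close>

lemma eval_rf_append_rows:
  fixes N :: "complex poly mat"
  assumes d: "poly d z \<noteq> 0"
  shows "map_mat (\<lambda>r. eval_rf r z) (map_mat (\<lambda>p. to_fract p / to_fract d) (N @\<^sub>r [:0, 1:] \<cdot>\<^sub>m N))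
    = (1 / poly d z) \<cdot>\<^sub>m map_mat (\<lambda>p. poly p z) N @\<^sub>r z \<cdot>\<^sub>m ((1 / poly d z) \<cdot>\<^sub>m map_mat (\<lambda>p. poly p z) N)"
  by (rule eq_matI) (auto simp: append_rows_def eval_rf_to_fract_divide[OF d])

context connected_weighted_graph
begin

lemma poly_pencil:
  "map_mat (\<lambda>f. poly f z) (pencil const_poly f g) = pencil complex_of_real (poly f z) (poly g z)"
  by (rule eq_matI) (auto simp: pencil_def const_poly_def)

text \<open>Applying \<open>Jc\<close> to a kernel vector shows that it has zero sum. On such
  vectors the pencil is p + q L, so the vector would be an eigenvector of \<open>L\<close> for - p /
  q.\<close>

lemma det_pencil_nonzero:
  assumes q: "q \<noteq> 0" and nz: "\<And>x. eigenvalue L x \<Longrightarrow> x > 0 \<Longrightarrow> p + q * of_real x \<noteq> 0"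
  shows "det (pencil complex_of_real p q) \<noteq> 0"
proof
  assume "det (pencil complex_of_real p q) = 0"
  then obtain v where v: "v \<in> carrier_vec n" "v \<noteq> 0\<^sub>v n" "pencil complex_of_real p q *\<^sub>v v = 0\<^sub>v n"
    using det_0_iff_vec_prod_zero[OF pencil_carrier] by blast
  have Jcc: "Jc \<in> carrier_mat n n" by simp
  have "Jc *\<^sub>v v = Jc *\<^sub>v (pencil complex_of_real p q *\<^sub>v v)"
    unfolding assoc_mult_mat_vec[OF Jcc pencil_carrier v(1), symmetric]
      pencil_products[OF comm_ring_hom_of_real] ..
  then have "Jc *\<^sub>v v = 0\<^sub>v n" unfolding v(3) by (auto intro!: eq_vecI)
  then have sum: "(\<Sum>i<n. v $ i) = 0" using Jc_mult_vec_zero_iff[OF v(1)] by simp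
  have eq: "p \<cdot>\<^sub>v v + q \<cdot>\<^sub>v (Lc *\<^sub>v v) = 0\<^sub>v n" using v(3) unfolding pencil_mult_vec[OF v(1) sum] .
  have "Lc *\<^sub>v v = (- p / q) \<cdot>\<^sub>v v"
  proof (rule eq_vecI)
    fix i assume "i < dim_vec ((- p / q) \<cdot>\<^sub>v v)"
    then have i: "i < n" using v by simp
    have "p * v $ i + q * (Lc *\<^sub>v v) $ i = 0"
      using arg_cong[OF eq, of "\<lambda>u. u $ i"] i v by (simp del: index_mult_mat_vec)
    then have "q * (Lc *\<^sub>v v) $ i = - p * v $ i" by (simp add: eq_neg_iff_add_eq_0 add.commute del: index_mult_mat_vec)
    then have "(Lc *\<^sub>v v) $ i = - p * v $ i / q" using q by (metis nonzero_mult_div_cancel_left)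
    then show "(Lc *\<^sub>v v) $ i = ((- p / q) \<cdot>\<^sub>v v) $ i"
      using i v by (simp del: index_mult_mat_vec)
  qed (use v in auto)
  then obtain x where x: "x > 0" "- p / q = of_real x" "eigenvalue L x"
    using Lc_eigenvector_sum_zero_pos[OF v(1,2) _ sum] by blast
  have "p + q * of_real x = 0" unfolding x(2)[symmetric] using q by simp
  with nz[of x] x show False by simp
qed

context
  fixes \<alpha> \<beta> a b :: real
  assumes \<alpha>: "\<alpha> > 0" and \<beta>: "\<beta> > 0" and a: "a \<ge> 0" and b: "b \<ge> 0" and ab: "a + b > 0"
begin

text \<open>The velocity feedback matrix \<open>a I + b L\<close> covers both protocols.\<close>

private abbreviation (input) "f \<equiv> [:0, complex_of_real (\<beta> * a), 1:]"
private abbreviation (input) "g \<equiv> [:complex_of_real \<alpha>, complex_of_real (\<beta> * b):]"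
private abbreviation (input) "N \<equiv> pencil_adj const_poly f g"
private abbreviation (input) "d \<equiv> det (pencil const_poly f g)"
private abbreviation (input) "sys \<equiv> transfer_matrix (state_matrix n \<alpha> \<beta> L (a \<cdot>\<^sub>m 1\<^sub>m n + b \<cdot>\<^sub>m L))
  (input_matrix n) (output_matrix n)"

lemma damping_pos: "x > 0 \<Longrightarrow> a + b * x > 0"
  using a b ab by (cases "a = 0") (auto simp: add_pos_nonneg)

text \<open>At s = i v this is the characteristic polynomial s^2 + \<beta> (a + b x) s + \<alpha> x
  of the mode \<open>x\<close>; its squared modulus is the denominator of
  \<open>mode_gain\<close>.\<close>

lemma norm_characteristic:
  "(cmod (poly f (\<i> * of_real v) + poly g (\<i> * of_real v) * of_real x))\<^sup>2
    = (\<alpha> * x - v\<^sup>2)\<^sup>2 + \<beta>\<^sup>2 * (a + b * x)\<^sup>2 * v\<^sup>2"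
proof -
  have "poly f (\<i> * of_real v) + poly g (\<i> * of_real v) * of_real x
    = Complex (\<alpha> * x - v\<^sup>2) (\<beta> * (a + b * x) * v)"
    by (simp add: complex_eq_iff power2_eq_square algebra_simps)
  then show ?thesis by (simp add: cmod_power2 power_mult_distrib)
qed

lemma characteristic_nonzero:
  assumes "x > 0"
  shows "poly f (\<i> * of_real v) + poly g (\<i> * of_real v) * of_real x \<noteq> 0"
proof
  assume "poly f (\<i> * of_real v) + poly g (\<i> * of_real v) * of_real x = 0"
  then have "(\<alpha> * x - v\<^sup>2)\<^sup>2 + \<beta>\<^sup>2 * (a + b * x)\<^sup>2 * v\<^sup>2 = 0"
    unfolding norm_characteristic[symmetric] by simp
  with mode_denominator_pos[OF \<alpha> \<beta> damping_pos[OF assms] assms, of "v\<^sup>2"] show False by simp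
qed

lemma poly_g_nonzero: "poly g (\<i> * of_real v) \<noteq> 0"
  using \<alpha> by (auto simp: complex_eq_iff)

text \<open>Includes v = 0, where s I - A itself is singular. Hence the fractions with denominator
  \<open>d\<close> may be evaluated on the whole imaginary axis.\<close>

lemma poly_det_nonzero: "poly d (\<i> * of_real v) \<noteq> 0"
proof -
  have "poly d (\<i> * of_real v) = det (map_mat (\<lambda>p. poly p (\<i> * of_real v)) (pencil const_poly f g))"
    by (rule comm_ring_hom.hom_det[OF poly_hom.comm_ring_hom_axioms, symmetric])
  also have "\<dots> = det (pencil complex_of_real (poly f (\<i> * of_real v)) (poly g (\<i> * of_real v)))"
    unfolding poly_pencil ..
  also have "\<dots> \<noteq> 0"
    by (rule det_pencil_nonzero) (use poly_g_nonzero characteristic_nonzero in blast)+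
  finally show ?thesis .
qed

lemma transfer_matrix_closed_loop:
  "sys = map_mat (\<lambda>p. to_fract p / to_fract d) (N @\<^sub>r [:0, 1:] \<cdot>\<^sub>m N)"
proof (rule transfer_matrix_eqI)
  have M: "a \<cdot>\<^sub>m 1\<^sub>m n + b \<cdot>\<^sub>m L \<in> carrier_mat n n" by simp
  show "state_matrix n \<alpha> \<beta> L (a \<cdot>\<^sub>m 1\<^sub>m n + b \<cdot>\<^sub>m L) \<in> carrier_mat (n + n) (n + n)"
    "input_matrix n \<in> carrier_mat (n + n) n" "output_matrix n \<in> carrier_mat (n + n) (n + n)"
    "N @\<^sub>r [:0, 1:] \<cdot>\<^sub>m N \<in> carrier_mat (n + n) n"
    by (auto simp: state_matrix_def input_matrix_def output_matrix_def intro!: four_block_carrier_mat)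
  show "d \<noteq> 0" using poly_det_nonzero[of 0] by auto
  show "output_matrix n * state_matrix n \<alpha> \<beta> L (a \<cdot>\<^sub>m 1\<^sub>m n + b \<cdot>\<^sub>m L)
    = state_matrix n \<alpha> \<beta> L (a \<cdot>\<^sub>m 1\<^sub>m n + b \<cdot>\<^sub>m L) * output_matrix n"
    by (rule output_state_commute[OF M])
      (simp add: mult_add_distrib_mat[of _ n n _ n] add_mult_distrib_mat[of _ n n _ _ n]
        mult_smult_distrib[of _ n n _ n] mult_smult_assoc_mat[of _ n n _ n] consensus_error_products)
  show "([:0, 1:] \<cdot>\<^sub>m 1\<^sub>m (n + n) - map_mat const_poly (state_matrix n \<alpha> \<beta> L (a \<cdot>\<^sub>m 1\<^sub>m n + b \<cdot>\<^sub>m L)))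
      * (N @\<^sub>r [:0, 1:] \<cdot>\<^sub>m N) = d \<cdot>\<^sub>m map_mat const_poly (output_matrix n * input_matrix n)"
    by (rule closed_loop_equation[OF pencil_adj_carrier
        pencil_adj_products(1)[OF const_poly.comm_ring_hom_axioms]])
qed

text \<open>Finiteness makes \<open>Max\<close> meaningful. The last claim omits the singular value
  0, which stems from the consensus direction and corresponds to no mode.\<close>

lemma singular_values_closed_loop:
  fixes v :: real
  defines "S \<equiv> singular_values (map_mat (\<lambda>r. eval_rf r (\<i> * of_real v)) sys)"
    and "\<gamma> \<equiv> \<lambda>x. sqrt (mode_gain \<alpha> \<beta> (a + b * x) x (v\<^sup>2))"
  shows "finite S" "eigenvalue L x \<Longrightarrow> x \<noteq> 0 \<Longrightarrow> \<gamma> x \<in> S"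
    "\<sigma> \<in> S \<Longrightarrow> \<sigma> \<noteq> 0 \<Longrightarrow> \<exists>x. eigenvalue L x \<and> x \<noteq> 0 \<and> \<sigma> = \<gamma> x"
proof -
  define z where "z = \<i> * complex_of_real v"
  define p where "p = poly f z"
  define q where "q = poly g z"
  define Y where "Y = (1 / poly d z) \<cdot>\<^sub>m map_mat (\<lambda>r. poly r z) N"
  have dz: "poly d z \<noteq> 0" unfolding z_def by (rule poly_det_nonzero)
  have Nc: "N \<in> carrier_mat n n" by simp
  have Nz: "map_mat (\<lambda>r. poly r z) N \<in> carrier_mat n n" by simp
  have Y: "Y \<in> carrier_mat n n" by (simp add: Y_def)
  let ?T = "map_mat (\<lambda>r. eval_rf r z) sys"
  have T: "?T = Y @\<^sub>r z \<cdot>\<^sub>m Y"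
    unfolding transfer_matrix_closed_loop Y_def by (rule eval_rf_append_rows[OF dz])
  have const_ev: "map_mat (\<lambda>r. poly r z) (map_mat const_poly A) = map_mat complex_of_real A" for A
    by (rule eq_matI) (auto simp: const_poly_def)
  have ev_smult: "map_mat (\<lambda>r. poly r z) (e \<cdot>\<^sub>m A) = poly e z \<cdot>\<^sub>m map_mat (\<lambda>r. poly r z) A" for e A
    by (rule eq_matI) auto
  have cancel: "(1 / poly d z) \<cdot>\<^sub>m (poly d z \<cdot>\<^sub>m A) = A" for A
    using dz by (intro eq_matI) auto
  have K: "map_mat (\<lambda>r. poly r z) (pencil const_poly f g) = pencil complex_of_real p q"
    unfolding p_def q_def by (rule poly_pencil)
  note prods = pencil_adj_products[OF const_poly.comm_ring_hom_axioms, of f g]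
  have ev0: "map_mat (\<lambda>r. poly r z) (0\<^sub>m n n) = 0\<^sub>m n n" by (rule eq_matI) auto
  have cc: "map_mat const_poly J \<in> carrier_mat n n" by simp
  have YK: "Y * pencil complex_of_real p q = \<Phi>c"
    using arg_cong[OF prods(2), of "map_mat (\<lambda>r. poly r z)"]
    unfolding semiring_hom.mat_hom_mult[OF poly_hom.semiring_hom_axioms, OF Nc pencil_carrier] K ev_smult const_ev Y_def
      mult_smult_assoc_mat[OF Nz pencil_carrier] by (simp only: cancel)
  have KY: "pencil complex_of_real p q * Y = \<Phi>c"
    using arg_cong[OF prods(3), of "map_mat (\<lambda>r. poly r z)"]
    unfolding semiring_hom.mat_hom_mult[OF poly_hom.semiring_hom_axioms, OF pencil_carrier Nc] K ev_smult const_ev Y_def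
      mult_smult_distrib[OF pencil_carrier Nz] by (simp only: cancel)
  have JY: "Jc * Y = 0\<^sub>m n n"
    using arg_cong[OF prods(4), of "map_mat (\<lambda>r. poly r z)"]
    unfolding semiring_hom.mat_hom_mult[OF poly_hom.semiring_hom_axioms, OF cc Nc] const_ev Y_def ev0
    by (subst mult_smult_distrib[OF _ Nz]) auto
  have YJ: "Y * Jc = 0\<^sub>m n n"
    using arg_cong[OF prods(5), of "map_mat (\<lambda>r. poly r z)"]
    unfolding semiring_hom.mat_hom_mult[OF poly_hom.semiring_hom_axioms, OF Nc cc] const_ev Y_def ev0
    by (subst mult_smult_assoc_mat[OF Nz]) auto
  define c where "c = 1 + v\<^sup>2"
  have c: "c > 0" unfolding c_def by (simp add: add_pos_nonneg)
  have q0: "q \<noteq> 0" unfolding q_def z_def by (rule poly_g_nonzero)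
  have G: "mat_adjoint ?T * ?T = of_real c \<cdot>\<^sub>m (mat_adjoint Y * Y)"
    unfolding T mat_adjoint_append_smult[OF Y] by (simp add: c_def z_def norm_mult)
  note assms' = q0 Y c YK KY JY YJ
  have S: "\<sigma> \<in> S \<longleftrightarrow> 0 \<le> \<sigma> \<and> eigenvalue (of_real c \<cdot>\<^sub>m (mat_adjoint Y * Y)) (of_real (\<sigma>\<^sup>2))" for \<sigma>
    unfolding S_def singular_values_def z_def[symmetric] G by simp
  have norm: "(cmod (p + q * of_real x))\<^sup>2 = (\<alpha> * x - v\<^sup>2)\<^sup>2 + \<beta>\<^sup>2 * (a + b * x)\<^sup>2 * v\<^sup>2" for x
    unfolding p_def q_def z_def by (rule norm_characteristic)
  have gain: "c / (cmod (p + q * of_real x))\<^sup>2 = mode_gain \<alpha> \<beta> (a + b * x) x (v\<^sup>2)" for x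
    unfolding norm mode_gain_def c_def ..
  have pos: "x > 0" if "eigenvalue L x" "x \<noteq> 0" for x using eigenvalue_L_vec[OF that] by blast
  have nz: "p + q * of_real x \<noteq> 0" if "eigenvalue L x" "x \<noteq> 0" for x
    unfolding p_def q_def z_def by (rule characteristic_nonzero[OF pos[OF that]])
  have nonneg: "mode_gain \<alpha> \<beta> (a + b * x) x (v\<^sup>2) \<ge> 0" if "eigenvalue L x" "x \<noteq> 0" for x
    using mode_gain_nonneg[OF \<alpha> \<beta> damping_pos[OF pos[OF that]] pos[OF that]] by simp
  have Gc: "of_real c \<cdot>\<^sub>m (mat_adjoint Y * Y) \<in> carrier_mat n n"
    using Y by auto
  show "finite S"
  proof (rule inj_on_finite[of "\<lambda>\<sigma>. complex_of_real (\<sigma>\<^sup>2)"])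
    show "inj_on (\<lambda>\<sigma>. complex_of_real (\<sigma>\<^sup>2)) S"
      by (rule inj_onI) (simp only: S of_real_eq_iff power2_eq_iff_nonneg)
    show "(\<lambda>\<sigma>. complex_of_real (\<sigma>\<^sup>2)) ` S \<subseteq> spectrum (of_real c \<cdot>\<^sub>m (mat_adjoint Y * Y))"
      using S by (auto simp: spectrum_def)
    show "finite (spectrum (of_real c \<cdot>\<^sub>m (mat_adjoint Y * Y)))"
      by (rule card_finite_spectrum(1)[OF Gc])
  qed
  show "\<gamma> x \<in> S" if "eigenvalue L x" "x \<noteq> 0"
    using eigenvalue_gramI[OF assms' that nz[OF that]] nonneg[OF that]
    unfolding S gain \<gamma>_def by simp
  show "\<exists>x. eigenvalue L x \<and> x \<noteq> 0 \<and> \<sigma> = \<gamma> x" if "\<sigma> \<in> S" "\<sigma> \<noteq> 0"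
  proof -
    have \<sigma>: "0 \<le> \<sigma>" "eigenvalue (of_real c \<cdot>\<^sub>m (mat_adjoint Y * Y)) (of_real (\<sigma>\<^sup>2))" "\<sigma>\<^sup>2 \<noteq> 0"
      using that S by auto
    obtain x where x: "eigenvalue L x" "x \<noteq> 0" "\<sigma>\<^sup>2 * (cmod (p + q * of_real x))\<^sup>2 = c"
      using eigenvalue_gramD[OF assms' \<sigma>(2,3)] by blast
    have "\<sigma>\<^sup>2 = c / (cmod (p + q * of_real x))\<^sup>2" using x(3) nz[OF x(1,2)] by (simp add: field_simps)
    then have "\<sigma> = \<gamma> x" unfolding gain \<gamma>_def using \<sigma>(1) by (metis real_sqrt_unique)
    then show ?thesis using x by blast
  qed
qed

text \<open>The mode \<open>x0\<close> contributes a singular value at every frequency, which gives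
  one inequality. For the other, any mode is dominated by \<open>x0\<close> at a lower or equal
  frequency, so the suprema agree although the pointwise maxima may not.\<close>

lemma hinf_norm_closed_loop:
  fixes x0 :: real
  defines "x0 \<equiv> min_nonzero_eigenvalue L"
  shows "hinf_norm sys = (SUP v::real. ereal (sqrt (mode_gain \<alpha> \<beta> (a + b * x0) x0 (v\<^sup>2))))"
proof (rule antisym)
  let ?S = "\<lambda>v. singular_values (map_mat (\<lambda>r. eval_rf r (\<i> * of_real v)) sys)"
  have x0: "eigenvalue L x0" "x0 \<noteq> 0" using min_nonzero_eigenvalue by (auto simp: x0_def)
  have x0pos: "x0 > 0" using eigenvalue_L_vec[OF x0] by blast
  note sv = singular_values_closed_loop
  have ne: "?S v \<noteq> {}" for v using sv(2)[OF x0] by blast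
  show "(SUP v::real. ereal (sqrt (mode_gain \<alpha> \<beta> (a + b * x0) x0 (v\<^sup>2)))) \<le> hinf_norm sys"
    unfolding hinf_norm_def max_singular_value_def
    by (rule SUP_mono) (use Max_ge[OF sv(1) sv(2)[OF x0]] in auto)
  show "hinf_norm sys \<le> (SUP v::real. ereal (sqrt (mode_gain \<alpha> \<beta> (a + b * x0) x0 (v\<^sup>2))))"
    unfolding hinf_norm_def max_singular_value_def
  proof (rule SUP_mono)
    fix v :: real
    define \<sigma> where "\<sigma> = Max (?S v)"
    have \<sigma>: "\<sigma> \<in> ?S v" unfolding \<sigma>_def by (rule Max_in[OF sv(1) ne])
    have "\<exists>w. \<sigma> \<le> sqrt (mode_gain \<alpha> \<beta> (a + b * x0) x0 (w\<^sup>2))"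
    proof (cases "\<sigma> = 0")
      case True
      then show ?thesis using mode_gain_nonneg[OF \<alpha> \<beta> damping_pos[OF x0pos] x0pos, of "v\<^sup>2"] by auto
    next
      case False
      then obtain x where x: "eigenvalue L x" "x \<noteq> 0" "\<sigma> = sqrt (mode_gain \<alpha> \<beta> (a + b * x) x (v\<^sup>2))"
        using sv(3)[OF \<sigma>] by blast
      have xpos: "x > 0" using eigenvalue_L_vec[OF x(1,2)] by blast
      have le: "x0 \<le> x" unfolding x0_def by (rule min_nonzero_eigenvalue(3)[OF x(1,2)])
      define r where "r = x0 / x"
      have r: "0 < r" "r \<le> 1" "r * x = x0" using le x0pos xpos by (auto simp: r_def)
      \<comment> \<open>The damping may shrink along with the eigenvalue, from a + b x to a + b x0,
        since \<open>b\<close> is non-negative.\<close>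
      have "mode_gain \<alpha> \<beta> (a + b * x) x (v\<^sup>2) \<le> mode_gain \<alpha> \<beta> (a + b * x0) (r * x) (r * v\<^sup>2)"
        by (rule mode_gain_scale)
          (use \<alpha> \<beta> damping_pos[OF x0pos] b le xpos r in \<open>auto intro: mult_left_mono\<close>)
      also have "r * v\<^sup>2 = (sqrt r * v)\<^sup>2" using r by (simp add: power_mult_distrib)
      finally show ?thesis unfolding x(3) r(3) by (intro exI[of _ "sqrt r * v"]) simp
    qed
    then show "\<exists>w\<in>UNIV. ereal (Max (?S v)) \<le> ereal (sqrt (mode_gain \<alpha> \<beta> (a + b * x0) x0 (w\<^sup>2)))"
      unfolding \<sigma>_def by simp
  qed
qed

end

lemma hinf_norm_protocols:
  assumes "\<alpha> > 0" "\<beta> > 0"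
  shows "hinf_norm (T_abs n L \<alpha> \<beta>)
      = (SUP v::real. ereal (sqrt (mode_gain \<alpha> \<beta> 1 (min_nonzero_eigenvalue L) (v\<^sup>2))))"
    and "hinf_norm (T_rel n L \<alpha> \<beta>)
      = (SUP v::real. ereal (sqrt (mode_gain \<alpha> \<beta> (min_nonzero_eigenvalue L) (min_nonzero_eigenvalue L) (v\<^sup>2))))"
proof -
  have 1: "(1 \<cdot>\<^sub>m 1\<^sub>m n + 0 \<cdot>\<^sub>m L :: real mat) = 1\<^sub>m n" "0 \<cdot>\<^sub>m 1\<^sub>m n + 1 \<cdot>\<^sub>m L = L"
    by (auto intro!: eq_matI)
  show "hinf_norm (T_abs n L \<alpha> \<beta>)
      = (SUP v::real. ereal (sqrt (mode_gain \<alpha> \<beta> 1 (min_nonzero_eigenvalue L) (v\<^sup>2))))"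
    using hinf_norm_closed_loop[of \<alpha> \<beta> 1 0] assms unfolding 1 T_abs_def by simp
  show "hinf_norm (T_rel n L \<alpha> \<beta>)
      = (SUP v::real. ereal (sqrt (mode_gain \<alpha> \<beta> (min_nonzero_eigenvalue L) (min_nonzero_eigenvalue L) (v\<^sup>2))))"
    using hinf_norm_closed_loop[of \<alpha> \<beta> 0 1] assms unfolding 1 T_rel_def by simp
qed

end

theorem theorem3:
  fixes n :: nat and W L :: "real mat" and lambda2 :: real
  assumes "n \<ge> 2"
    and "adjacency_matrix n W"
    and "connected_graph n W"
    and "L = laplacian n W"
    and "lambda2 = min_nonzero_eigenvalue L"
  shows "(lambda2 < 1 \<longrightarrow>
            (\<forall>\<alpha>>0. \<forall>\<beta>>0. hinf_norm (T_abs n L \<alpha> \<beta>) \<le> hinf_norm (T_rel n L \<alpha> \<beta>))) \<and>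
         (lambda2 > 1 \<longrightarrow>
            (\<forall>\<alpha>>0. \<forall>\<beta>>0. hinf_norm (T_rel n L \<alpha> \<beta>) \<le> hinf_norm (T_abs n L \<alpha> \<beta>))) \<and>
         (lambda2 = 1 \<longrightarrow>
            (\<forall>\<alpha>>0. \<forall>\<beta>>0. hinf_norm (T_abs n L \<alpha> \<beta>) = hinf_norm (T_rel n L \<alpha> \<beta>)))"
proof -
  interpret G: connected_weighted_graph n W
    using assms by unfold_locales
  have ev: "eigenvalue (laplacian n W) lambda2" "lambda2 \<noteq> 0"
    using G.min_nonzero_eigenvalue(1,2) assms by auto
  have pos: "lambda2 > 0" using G.eigenvalue_L_vec[OF ev] by blast
  note abs = G.hinf_norm_protocols(1)[folded assms(4), folded assms(5)]
  note rel = G.hinf_norm_protocols(2)[folded assms(4), folded assms(5)]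
  \<comment> \<open>Both comparisons are proved under non-strict bounds on \<open>lambda2\<close>,
    so the case of equality follows by antisymmetry.\<close>
  have "hinf_norm (T_abs n L \<alpha> \<beta>) \<le> hinf_norm (T_rel n L \<alpha> \<beta>)"
    if "lambda2 \<le> 1" "\<alpha> > 0" "\<beta> > 0" for \<alpha> \<beta>
    unfolding abs[OF that(2,3)] rel[OF that(2,3)]
    by (intro SUP_mono' ereal_less_eq(3)[THEN iffD2] real_sqrt_le_mono mode_gain_antimono)
      (use that pos in auto)
  moreover have "hinf_norm (T_rel n L \<alpha> \<beta>) \<le> hinf_norm (T_abs n L \<alpha> \<beta>)"
    if "lambda2 \<ge> 1" "\<alpha> > 0" "\<beta> > 0" for \<alpha> \<beta>
    unfolding abs[OF that(2,3)] rel[OF that(2,3)]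
    by (intro SUP_mono' ereal_less_eq(3)[THEN iffD2] real_sqrt_le_mono mode_gain_antimono)
      (use that pos in auto)
  ultimately show ?thesis by (auto intro!: antisym)
qed

end
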